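(* Let $s\ge 2$ and $n \geq 4s+3$ be integers, and suppose $\mathcal{F} \subseteq \binom{[n]}{3}_{s\text{-stable}}$ is a non-star intersecting family. Then $$|\mathcal{F}| \leq 3n - 10s + 2.$$ Moreover, equality holds if and only if $\mathcal{F}\cong \mathcal{F}_s(\{1,s+1,2s+1\})$ or $\mathcal{F}\cong \mathcal{G}_s(1, \{s + 1, y, n - s + 1\})$ for some integer $y \in [2s + 1, n - 2s + 1]$.
   Context: Write $[n]=\{1,\dots,n\}$ and $[a,b]$ for the integers from $a$ to $b$. For $i,j\in[n]$ with $i\le j$ let $d(i,j)=d(j,i)=\min\{j-i,\ n+i-j\}$. A set $A\subseteq[n]$ is $s$-stable if $d(i,j)\ge s$ for all distinct $i,j\in A$; $\binom{[n]}{k}_{s\text{-stable}}$ is the collection of all $s$-stable $k$-element subsets of $[n]$. A family of sets is intersecting if every two of its members intersect. An intersecting family $\mathcal{F}$ is a star if $\bigcap_{F\in\mathcal{F}}F\neq\emptyset$, and a non-star otherwise. For a 3-element set $X\subseteq[n]$, let $\mathcal{F}_s(X)=\{F\in\binom{[n]}{3}_{s\text{-stable}} : |F\cap X|\ge 2\}$. For $x\in[n]$ and $Y\in\binom{[n]}{3}_{s\text{-stable}}$ with $x\notin Y$, let $\mathcal{G}_s(x,Y)=\{Y\}\cup\{F\in\binom{[n]}{3}_{s\text{-stable}} : x\in F,\ F\cap Y\neq\emptyset\}$. Two families $\mathcal{F},\mathcal{G}$ of $k$-element subsets of $[n]$ are isomorphic, written $\mathcal{F}\cong\mathcal{G}$,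 if there is a permutation $\pi$ of $[n]$ such that $\{x_1,\dots,x_k\}\in\mathcal{F}$ if and only if $\{\pi(x_1),\dots,\pi(x_k)\}\in\mathcal{G}$. *)

theory Defs
  imports Main "HOL-Combinatorics.Permutations"
begin

text \<open>
  The ground set is \<open>{1..n}\<close> of type \<^typ>\<open>nat\<close>. For \<open>i, j\<close> in \<open>{1..n}\<close>
  the subtractions below do not truncate.
\<close>

definition cdist :: "nat \<Rightarrow> nat \<Rightarrow> nat \<Rightarrow> nat" where
  "cdist n i j = (if i \<le> j then min (j - i) (n + i - j) else min (i - j) (n + j - i))"

definition stable :: "nat \<Rightarrow> nat \<Rightarrow> nat set \<Rightarrow> bool" where
  "stable n s A \<longleftrightarrow> A \<subseteq> {1..n} \<and> (\<forall>i\<in>A. \<forall>j\<in>A. i \<noteq> j \<longrightarrow> s \<le> cdist n i j)"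

definition stable_subsets :: "nat \<Rightarrow> nat \<Rightarrow> nat \<Rightarrow> nat set set" where
  "stable_subsets n k s = {A. stable n s A \<and> card A = k}"

definition intersecting :: "'a set set \<Rightarrow> bool" where
  "intersecting \<F> \<longleftrightarrow> (\<forall>A\<in>\<F>. \<forall>B\<in>\<F>. A \<inter> B \<noteq> {})"

text \<open>
  Since \<open>\<Inter>{} = UNIV\<close>, the empty family counts as a star.
\<close>

definition star :: "'a set set \<Rightarrow> bool" where
  "star \<F> \<longleftrightarrow> intersecting \<F> \<and> \<Inter>\<F> \<noteq> {}"

definition nonstar :: "'a set set \<Rightarrow> bool" where
  "nonstar \<F> \<longleftrightarrow> intersecting \<F> \<and> \<not> star \<F>"

definition family_F :: "nat \<Rightarrow> nat \<Rightarrow> nat set \<Rightarrow> nat set set" where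
  "family_F n s X = {F \<in> stable_subsets n 3 s. 2 \<le> card (F \<inter> X)}"

definition family_G :: "nat \<Rightarrow> nat \<Rightarrow> nat \<Rightarrow> nat set \<Rightarrow> nat set set" where
  "family_G n s x Y = {Y} \<union> {F \<in> stable_subsets n 3 s. x \<in> F \<and> F \<inter> Y \<noteq> {}}"

text \<open>
  Isomorphism of families of \<open>k\<close>-element subsets of \<open>{1..n}\<close>; the permutation of
  \<open>{1..n}\<close> is arbitrary and need not preserve \<^const>\<open>cdist\<close>.
\<close>

definition family_iso :: "nat \<Rightarrow> nat \<Rightarrow> nat set set \<Rightarrow> nat set set \<Rightarrow> bool" where
  "family_iso n k \<F> \<G> \<longleftrightarrow>
     (\<exists>\<pi>. \<pi> permutes {1..n} \<and>
        (\<forall>A. A \<subseteq> {1..n} \<and> card A = k \<longrightarrow> (A \<in> \<F> \<longleftrightarrow> \<pi> ` A \<in> \<G>)))"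

end

theory Submission
  imports Defs
begin

text \<open>
  If some pair \<open>{x, y}\<close> meets every member of the family, then the links of \<open>x\<close> (over members
  missing \<open>y\<close>) and of \<open>y\<close> (over members missing \<open>x\<close>) are nonempty cross-intersecting
  graphs. Either one of them is a single edge, which puts the family inside some
  \<open>\<G>\<^sub>s(x, Y)\<close> or \<open>\<G>\<^sub>s(y, Y)\<close>; or both are stars with a common centre \<open>v\<close>, which
  puts it inside \<open>\<F>\<^sub>s({x, y, v})\<close>; or the family is strictly smaller than the bound.
  If no such pair exists, every two points lie in at most three common members, and the same
  classification of links, applied to two points shared by two members, leaves at most
  \<open>13 < 2s + 11\<close> members.

  The sizes of \<open>\<F>\<^sub>s(X)\<close> and \<open>\<G>\<^sub>s(x, Y)\<close> reduce to codegrees of pairs at cyclic distance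
  \<open>d \<ge> s\<close>, which equal \<open>n - 2s + 1 - min d (2s - 1)\<close>. In both cases three such pairs occur, and
  equality in the bound forces two of the distances to be \<open>s\<close>; a rotation then gives the normal form.
\<close>

subsection \<open>Cross-intersecting graphs\<close>

lemma card_2_other:
  assumes "card e = 2" "v \<in> e" obtains b where "e = {v, b}" "b \<noteq> v"
  using assms by (metis card_2_iff insert_commute insertE singletonD)

text \<open>Intersecting edges form a star or a triangle. If three edges of \<open>A\<close> share
  \<open>v\<close>, an edge of \<open>B\<close> missing \<open>v\<close> would have to contain all
  three other ends; if \<open>A\<close> is just \<open>{v, b}\<close> and \<open>{v, c}\<close>,
  only \<open>{b, c}\<close> can miss \<open>v\<close>. If \<open>A\<close> is a triangle,
  \<open>B\<close> lies inside the same triangle; the bound 4 is chosen to agree with the case of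
  disjoint edges.\<close>

lemma cross_intersecting_intersecting:
  fixes A B :: "'a set set"
  assumes "A \<noteq> {}"
    and cA: "\<And>e. e \<in> A \<Longrightarrow> card e = 2" and cB: "\<And>e. e \<in> B \<Longrightarrow> card e = 2"
    and cross: "\<And>e f. e \<in> A \<Longrightarrow> f \<in> B \<Longrightarrow> e \<inter> f \<noteq> {}"
    and int: "\<And>e f. e \<in> A \<Longrightarrow> f \<in> A \<Longrightarrow> e \<inter> f \<noteq> {}"
  shows "card A = 1 \<or> (\<exists>v. \<forall>e\<in>A \<union> B. v \<in> e) \<or> card A \<le> 4 \<and> card B \<le> 4 \<or>
    (\<exists>v. card A \<le> 2 \<and> card {e \<in> B. v \<notin> e} \<le> 1)"
proof (cases "card A = 1")
  case False
  obtain e where e: "e \<in> A" using \<open>A \<noteq> {}\<close> by auto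
  have "A \<noteq> {e}" using False by auto
  then obtain f where f: "f \<in> A" "f \<noteq> e" using e by auto
  obtain v where v: "v \<in> e" "v \<in> f" using int[OF e f(1)] by auto
  obtain b where b: "e = {v, b}" "b \<noteq> v" using card_2_other[OF cA[OF e] v(1)] .
  obtain c where c: "f = {v, c}" "c \<noteq> v" using card_2_other[OF cA[OF f(1)] v(2)] .
  have bc: "b \<noteq> c" using b c f by auto
  have two: "h = {b, c}" if "card h = 2" "h \<inter> e \<noteq> {}" "h \<inter> f \<noteq> {}" "v \<notin> h" for h
    using that b c bc by (auto simp: card_2_iff)
  show ?thesis
  proof (cases "\<forall>h\<in>A. v \<in> h")
    case True
    show ?thesis
    proof (cases "A = {e, f}")
      case True
      have "h = {b, c}" if "h \<in> B" "v \<notin> h" for h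
        using two[of h] cB cross[OF e] cross[OF f(1)] that by (simp add: Int_commute)
      then have "{h \<in> B. v \<notin> h} \<subseteq> {{b, c}}" by blast
      then have "card {h \<in> B. v \<notin> h} \<le> 1" using card_mono[of "{{b, c}}"] by force
      moreover have "card A \<le> 2" using True by (simp add: card_insert_if)
      ultimately show ?thesis by blast
    next
      case F: False
      then obtain g where g: "g \<in> A" "g \<noteq> e" "g \<noteq> f" using e f by auto
      then obtain d where d: "g = {v, d}" using True card_2_other[OF cA] by metis
      have "v \<in> h" if "h \<in> B" for h
      proof (rule ccontr)
        assume "v \<notin> h"
        then have "h = {b, c}" using two[of h] cB cross[OF e] cross[OF f(1)] that by (simp add: Int_commute)
        then show False using cross[OF g(1) that] d g b c \<open>v \<notin> h\<close> by auto
      qed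
      then show ?thesis using True by blast
    qed
  next
    case F: False
    have tri: "h \<in> {e, f, {b, c}}" 
      if "card h = 2" "h \<inter> e \<noteq> {}" "h \<inter> f \<noteq> {}" "h \<inter> {b, c} \<noteq> {}" for h
      using that b c bc by (auto simp: card_2_iff doubleton_eq_iff)
    have bcA: "{b, c} \<in> A" using F two e f(1) cA int by metis
    have "A \<subseteq> {e, f, {b, c}}"
    proof
      fix h assume "h \<in> A"
      then show "h \<in> {e, f, {b, c}}" by (intro tri cA int e f(1) bcA)
    qed
    moreover have "B \<subseteq> {e, f, {b, c}}"
    proof
      fix h assume h: "h \<in> B"
      show "h \<in> {e, f, {b, c}}"
        using cross[OF e h] cross[OF f(1) h] cross[OF bcA h] cB[OF h] tri
        by (metis Int_commute)
    qed
    moreover have "card {e, f, {b, c}} \<le> 4" by (simp add: card_insert_if)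
    ultimately show ?thesis using card_mono[of "{e, f, {b, c}}"] by (meson finite.intros order_trans)
  qed
qed simp

text \<open>An edge meeting two disjoint edges has one end in each, which leaves 2 * 2
  choices.\<close>

lemma card_cross_disjoint_pair:
  fixes B :: "'a set set"
  assumes "card e = 2" "card f = 2" "e \<inter> f = {}"
    and "\<And>h. h \<in> B \<Longrightarrow> card h = 2 \<and> h \<inter> e \<noteq> {} \<and> h \<inter> f \<noteq> {}"
  shows "card B \<le> 4"
proof -
  have "B \<subseteq> (\<lambda>(a, b). {a, b}) ` (e \<times> f)"
  proof
    fix h assume "h \<in> B"
    then obtain a b where ab: "a \<in> h" "a \<in> e" "b \<in> h" "b \<in> f" "card h = 2" using assms(4) by blast
    then have "a \<noteq> b" using assms(3) by auto
    then have "h = {a, b}" using ab by (auto simp: card_2_iff)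
    then show "h \<in> (\<lambda>(a, b). {a, b}) ` (e \<times> f)" using ab by auto
  qed
  moreover have fin: "finite (e \<times> f)" using assms(1,2) by (simp add: card_ge_0_finite)
  ultimately have "card B \<le> card (e \<times> f)" by (meson surj_card_le)
  then show ?thesis using assms by (simp add: card_cartesian_product)
qed

text \<open>If neither graph is intersecting, each contains two disjoint edges, and these limit the
  other graph to four edges. Otherwise the preceding classification applies to whichever graph is
  intersecting.\<close>

lemma cross_intersecting_pairs:
  fixes A B :: "'a set set"
  assumes ne: "A \<noteq> {}" "B \<noteq> {}"
    and cA: "\<forall>e\<in>A. card e = 2" and cB: "\<forall>e\<in>B. card e = 2"
    and cross: "\<forall>e\<in>A. \<forall>f\<in>B. e \<inter> f \<noteq> {}"
  obtains (single_left) "card A = 1" | (single_right) "card B = 1"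
    | (common) v where "\<forall>e\<in>A \<union> B. v \<in> e" 
    | (small) "card A \<le> 4" "card B \<le> 4"
    | (left) v where "card A \<le> 2" "card {e \<in> B. v \<notin> e} \<le> 1"
    | (right) v where "card B \<le> 2" "card {e \<in> A. v \<notin> e} \<le> 1"
proof -
  consider (1) "\<forall>e\<in>A. \<forall>f\<in>A. e \<inter> f \<noteq> {}" | (2) "\<forall>e\<in>B. \<forall>f\<in>B. e \<inter> f \<noteq> {}"
    | (3) e f e' f' where "e \<in> A" "f \<in> A" "e \<inter> f = {}" "e' \<in> B" "f' \<in> B" "e' \<inter> f' = {}"
    by blast
  then show thesis
  proof cases
    case 1
    have "card A = 1 \<or> (\<exists>v. \<forall>e\<in>A \<union> B. v \<in> e) \<or> card A \<le> 4 \<and> card B \<le> 4 \<or>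
      (\<exists>v. card A \<le> 2 \<and> card {e \<in> B. v \<notin> e} \<le> 1)"
      by (rule cross_intersecting_intersecting) (use 1 assms(1-5) in simp_all)
    then show ?thesis using that(1,3-5) by metis
  next
    case 2
    have cross': "\<forall>f\<in>B. \<forall>e\<in>A. f \<inter> e \<noteq> {}" using cross by (metis Int_commute)
    have "card B = 1 \<or> (\<exists>v. \<forall>e\<in>B \<union> A. v \<in> e) \<or> card B \<le> 4 \<and> card A \<le> 4 \<or>
      (\<exists>v. card B \<le> 2 \<and> card {e \<in> A. v \<notin> e} \<le> 1)"
      by (rule cross_intersecting_intersecting) (use 2 assms(1-4) cross' in simp_all)
    then show ?thesis using that(2-4,6) by (metis Un_commute)
  next
    case 3
    have B4: "card B \<le> 4"
    proof (rule card_cross_disjoint_pair[of e f])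
      show "card h = 2 \<and> h \<inter> e \<noteq> {} \<and> h \<inter> f \<noteq> {}" if "h \<in> B" for h
        using 3(1,2) cB cross that by (simp add: Int_commute)
    qed (use 3 cA in auto)
    have "card A \<le> 4"
    proof (rule card_cross_disjoint_pair[of e' f'])
      show "card h = 2 \<and> h \<inter> e' \<noteq> {} \<and> h \<inter> f' \<noteq> {}" if "h \<in> A" for h
        using 3(4,5) cA cross that by simp
    qed (use 3 cB in auto)
    then show ?thesis using B4 by (rule that(4))
  qed
qed

section \<open>Links of points in families of triples\<close>

lemma link_pairs:
  assumes "\<And>F. F \<in> \<F> \<Longrightarrow> card F = 3 \<and> x \<in> F"
  shows "card ((\<lambda>F. F - {x}) ` \<F>) = card \<F>"
    and "e \<in> (\<lambda>F. F - {x}) ` \<F> \<Longrightarrow> card e = 2"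
proof -
  have "inj_on (\<lambda>F. F - {x}) \<F>" using assms by (intro inj_onI) (metis insert_Diff)
  then show "card ((\<lambda>F. F - {x}) ` \<F>) = card \<F>" by (rule card_image)
  show "e \<in> (\<lambda>F. F - {x}) ` \<F> \<Longrightarrow> card e = 2" using assms by auto
qed

text \<open>Deleting \<open>x\<close> from the members of \<open>P\<close> and \<open>y\<close> from
  those of \<open>Q\<close> gives cross-intersecting graphs, since a common point of
  \<open>F\<close> and \<open>G\<close> is neither \<open>x\<close> nor \<open>y\<close>. The
  condition \<open>v = y \<or> v \<notin> F\<close> says that \<open>v\<close> is not in the link
  edge \<open>F - {y}\<close>.\<close>

lemma cross_intersecting_links:
  fixes P Q :: "'a set set"
  assumes ne: "P \<noteq> {}" "Q \<noteq> {}"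
    and cP: "\<forall>F\<in>P. card F = 3 \<and> x \<in> F \<and> y \<notin> F"
    and cQ: "\<forall>F\<in>Q. card F = 3 \<and> y \<in> F \<and> x \<notin> F"
    and cross: "\<forall>F\<in>P. \<forall>G\<in>Q. F \<inter> G \<noteq> {}"
  obtains (single_left) "card P = 1" | (single_right) "card Q = 1"
    | (common) v where "v \<noteq> x" "v \<noteq> y" "\<forall>F\<in>P \<union> Q. v \<in> F" 
    | (small) "card P \<le> 4" "card Q \<le> 4"
    | (left) v where "card P \<le> 2" "card {F \<in> Q. v = y \<or> v \<notin> F} \<le> 1"
    | (right) v where "card Q \<le> 2" "card {F \<in> P. v = x \<or> v \<notin> F} \<le> 1"
proof -
  let ?A = "(\<lambda>F. F - {x}) ` P" and ?B = "(\<lambda>F. F - {y}) ` Q"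
  have cA: "card ?A = card P" "\<forall>e\<in>?A. card e = 2" using link_pairs[of P x] cP by blast+
  have cB: "card ?B = card Q" "\<forall>e\<in>?B. card e = 2" using link_pairs[of Q y] cQ by blast+
  have cr: "\<forall>e\<in>?A. \<forall>f\<in>?B. e \<inter> f \<noteq> {}"
  proof (intro ballI)
    fix e f assume "e \<in> ?A" "f \<in> ?B"
    then obtain F G where FG: "F \<in> P" "e = F - {x}" "G \<in> Q" "f = G - {y}" by blast
    obtain z where "z \<in> F" "z \<in> G" using cross FG by blast
    then have "z \<in> e \<inter> f" using cP cQ FG by auto
    then show "e \<inter> f \<noteq> {}" by blast
  qed
  have sub: "card {F \<in> Q. v = y \<or> v \<notin> F} = card {e \<in> ?B. v \<notin> e}" for v
  proof -
    have "{e \<in> ?B. v \<notin> e} = (\<lambda>F. F - {y}) ` {F \<in> Q. v = y \<or> v \<notin> F}" by auto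
    then show ?thesis using link_pairs(1)[of "{F \<in> Q. v = y \<or> v \<notin> F}" y] cQ by simp
  qed
  have sub': "card {F \<in> P. v = x \<or> v \<notin> F} = card {e \<in> ?A. v \<notin> e}" for v
  proof -
    have "{e \<in> ?A. v \<notin> e} = (\<lambda>F. F - {x}) ` {F \<in> P. v = x \<or> v \<notin> F}" by auto
    then show ?thesis using link_pairs(1)[of "{F \<in> P. v = x \<or> v \<notin> F}" x] cP by simp
  qed
  have "?A \<noteq> {}" "?B \<noteq> {}" using ne by auto
  from this cA(2) cB(2) cr show thesis
  proof (cases rule: cross_intersecting_pairs)
    case (common v)
    then have "v \<noteq> x" "v \<noteq> y" "\<forall>F\<in>P \<union> Q. v \<in> F" using ne by auto
    then show ?thesis by (rule that(3))
  next
    case single_left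
    show ?thesis by (rule that(1)) (use single_left cA in simp)
  next
    case single_right
    show ?thesis by (rule that(2)) (use single_right cB in simp)
  next
    case small
    show ?thesis by (rule that(4)) (use small cA cB in simp_all)
  next
    case (left v)
    show ?thesis by (rule that(5)[of v]) (use left cA sub in simp_all)
  next
    case (right v)
    show ?thesis by (rule that(6)[of v]) (use right cB sub' in simp_all)
  qed
qed

subsection \<open>Families without a cover of size two\<close>

lemma card_le_sum_codegrees:
  fixes \<F> :: "'a set set"
  assumes "finite \<F>" "card T = 3" "\<And>F. F \<in> \<F> \<Longrightarrow> F \<inter> T \<noteq> {}"
    and "\<And>y. y \<in> T \<Longrightarrow> card {F \<in> \<F>. y \<in> F} \<le> k"
  shows "card \<F> \<le> 3 * k"
proof -
  have fT: "finite T" using assms(2) by (simp add: card_ge_0_finite)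
  have "\<F> \<subseteq> (\<Union>y\<in>T. {F \<in> \<F>. y \<in> F})" using assms(3) by blast
  then have "card \<F> \<le> card (\<Union>y\<in>T. {F \<in> \<F>. y \<in> F})" using assms(1) fT by (intro card_mono) auto
  also have "\<dots> \<le> (\<Sum>y\<in>T. card {F \<in> \<F>. y \<in> F})" by (rule card_UN_le[OF fT])
  also have "\<dots> \<le> (\<Sum>y\<in>T. k)" by (intro sum_mono assms(4))
  finally show ?thesis using assms(2) by simp
qed

text \<open>If no two members share two points, codegrees are at most 1, degrees at most 3 and the
  family has at most 9 members. Otherwise two members \<open>{x, y, a}\<close> and
  \<open>{x, y, b}\<close> exist, and the family is split by its trace on \<open>{x, y}\<close>: at
  most 2 members miss both points, at most 3 contain both, and at most 8 contain exactly
  one.\<close>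

lemma card_no_two_cover:
  fixes \<F> :: "'a set set"
  assumes fin: "finite \<F>" and c3: "\<And>F. F \<in> \<F> \<Longrightarrow> card F = 3"
    and int: "\<And>F G. F \<in> \<F> \<Longrightarrow> G \<in> \<F> \<Longrightarrow> F \<inter> G \<noteq> {}"
    and nc: "\<And>x y. \<exists>F\<in>\<F>. x \<notin> F \<and> y \<notin> F"
  shows "card \<F> \<le> 13"
proof (cases "\<exists>F\<in>\<F>. \<exists>G\<in>\<F>. F \<noteq> G \<and> 2 \<le> card (F \<inter> G)")
  case False
  have cod: "card {F \<in> \<F>. x \<in> F \<and> y \<in> F} \<le> 1" if "x \<noteq> y" for x y
  proof (rule ccontr)
    assume "\<not> ?thesis"
    then obtain F G where FG: "F \<in> \<F>" "G \<in> \<F>" "{x, y} \<subseteq> F" "{x, y} \<subseteq> G" "F \<noteq> G"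
      using fin by (fastforce simp: card_le_Suc0_iff_eq)
    have "card {x, y} \<le> card (F \<inter> G)" using FG c3 by (intro card_mono) (auto simp: card_ge_0_finite)
    then have "2 \<le> card (F \<inter> G)" using that by simp
    then show False using False FG by blast
  qed
  have deg: "card {F \<in> \<F>. x \<in> F} \<le> 3" for x
  proof -
    obtain T where T: "T \<in> \<F>" "x \<notin> T" using nc by blast
    have "card {F \<in> \<F>. x \<in> F} \<le> 3 * 1"
    proof (rule card_le_sum_codegrees)
      show "F \<inter> T \<noteq> {}" if "F \<in> {F \<in> \<F>. x \<in> F}" for F using that int T by blast
      show "card {F \<in> {F \<in> \<F>. x \<in> F}. y \<in> F} \<le> 1" if "y \<in> T" for y
        using cod[of x y] that T by (simp add: conj_assoc) metis
    qed (use fin c3 T in auto)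
    then show ?thesis by simp
  qed
  obtain T where "T \<in> \<F>" using nc by blast
  then have "card \<F> \<le> 3 * 3" using deg fin c3 int by (intro card_le_sum_codegrees[of \<F> T 3]) auto
  then show ?thesis by simp
next
  case True
  then obtain F G where FG: "F \<in> \<F>" "G \<in> \<F>" "F \<noteq> G" "2 \<le> card (F \<inter> G)" by blast
  obtain x y where xy: "x \<noteq> y" "x \<in> F" "x \<in> G" "y \<in> F" "y \<in> G"
    using FG(4) by (metis IntE card_le_Suc0_iff_eq card_eq_0_iff not_less_eq_eq numeral_2_eq_2 zero_le bot_nat_0.extremum)
  obtain a where a: "F = {x, y, a}" "a \<notin> {x, y}"
    using xy c3[OF FG(1)] by (auto simp: card_3_iff)
  obtain b where b: "G = {x, y, b}" "b \<notin> {x, y}"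
    using xy c3[OF FG(2)] by (auto simp: card_3_iff)
  have ab: "a \<noteq> b" using a b FG by auto
  \<comment> \<open>Some member \<open>T\<close> misses \<open>u\<close> and \<open>v\<close>; a
    member through both is determined by a point it shares with \<open>T\<close>.\<close>
  have cod: "card {H \<in> \<F>. u \<in> H \<and> v \<in> H} \<le> 3" if "u \<noteq> v" for u v
  proof -
    obtain T where T: "T \<in> \<F>" "u \<notin> T" "v \<notin> T" using nc by blast
    have "{H \<in> \<F>. u \<in> H \<and> v \<in> H} \<subseteq> (\<lambda>w. {u, v, w}) ` T"
    proof safe
      fix H assume H: "H \<in> \<F>" "u \<in> H" "v \<in> H"
      then obtain w where "w \<in> H" "w \<in> T" using int T by blast
      then have "H = {u, v, w}" using T H c3[OF H(1)] that by (auto simp: card_3_iff)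
      then show "H \<in> (\<lambda>w. {u, v, w}) ` T" using \<open>w \<in> T\<close> by auto
    qed
    then show ?thesis using surj_card_le[of T] c3[OF T(1)] by (metis card.infinite zero_neq_numeral)
  qed
  let ?N = "{H \<in> \<F>. x \<notin> H \<and> y \<notin> H}" and ?M = "{H \<in> \<F>. x \<in> H \<and> y \<in> H}"
  let ?P = "{H \<in> \<F>. x \<in> H \<and> y \<notin> H}" and ?Q = "{H \<in> \<F>. y \<in> H \<and> x \<notin> H}"
  have N_ab: "a \<in> H \<and> b \<in> H" if "H \<in> ?N" for H
    using that int[OF _ FG(1), of H] int[OF _ FG(2), of H] a b by auto
  have N: "card ?N \<le> 2"
  proof -
    obtain T where T: "T \<in> \<F>" "a \<notin> T" "b \<notin> T" using nc by blast
    \<comment> \<open>\<open>T\<close> meets \<open>F\<close> but misses \<open>a\<close>, so it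
      contains \<open>x\<close> or \<open>y\<close>, which no member of \<open>?N\<close> does. At
      most two points of \<open>T\<close> remain as third point next to \<open>a\<close> and
      \<open>b\<close>.\<close>
    have TT: "T \<inter> {x, y} \<noteq> {}" using int[OF T(1) FG(1)] T a by auto
    have "?N \<subseteq> (\<lambda>w. {a, b, w}) ` (T - {x, y})"
    proof
      fix H assume H: "H \<in> ?N"
      then have "a \<in> H" "b \<in> H" using N_ab by blast+
      obtain w where "w \<in> H" "w \<in> T" using int T H by blast
      then have "H = {a, b, w}" using T H c3[of H] \<open>a \<in> H\<close> \<open>b \<in> H\<close> ab by (auto simp: card_3_iff)
      then show "H \<in> (\<lambda>w. {a, b, w}) ` (T - {x, y})" using \<open>w \<in> T\<close> H by auto
    qed
    moreover have fT: "finite T" using c3[OF T(1)] by (simp add: card_ge_0_finite)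
    moreover have "card (T - {x, y}) < card T" using TT fT by (intro psubset_card_mono) auto
    ultimately show ?thesis using surj_card_le[of "T - {x, y}" ?N] c3[OF T(1)] by fastforce
  qed
  have M: "card ?M \<le> 3" using cod xy by blast
  have disj: "card \<F> \<le> card ?N + card ?M + card ?P + card ?Q"
  proof -
    have "\<F> = ?N \<union> ?M \<union> ?P \<union> ?Q" by auto
    then show ?thesis by (smt (verit) card_Un_le nat_add_left_cancel_le add.commute order_trans add_mono_thms_linordered_semiring(3))
  qed
  \<comment> \<open>A member missing \<open>y\<close> and \<open>a\<close> cannot lie in
    \<open>?N\<close>, whose members contain \<open>a\<close>, so it contains \<open>x\<close>;
    likewise with \<open>x\<close> and \<open>y\<close> exchanged.\<close>
  have P: "?P \<noteq> {}" and Q: "?Q \<noteq> {}" using nc[of y a] nc[of x a] N_ab by blast+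
  \<comment> \<open>The members not counted on the right contain both \<open>y\<close> and
    \<open>v\<close>, so the codegree bound 3 applies to them.\<close>
  have cQ: "card ?Q \<le> card {H \<in> ?Q. v = y \<or> v \<notin> H} + 3" for v
  proof (cases "v = y")
    case False
    have "?Q \<subseteq> {H \<in> ?Q. v = y \<or> v \<notin> H} \<union> {H \<in> \<F>. y \<in> H \<and> v \<in> H}" by auto
    then have "card ?Q \<le> card ({H \<in> ?Q. v = y \<or> v \<notin> H} \<union> {H \<in> \<F>. y \<in> H \<and> v \<in> H})"
      using fin by (intro card_mono) auto
    also have "\<dots> \<le> card {H \<in> ?Q. v = y \<or> v \<notin> H} + card {H \<in> \<F>. y \<in> H \<and> v \<in> H}" by (rule card_Un_le)
    finally show ?thesis using cod[OF False[symmetric]] by linarith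
  qed simp
  have cP: "card ?P \<le> card {H \<in> ?P. v = x \<or> v \<notin> H} + 3" for v
  proof (cases "v = x")
    case False
    have "?P \<subseteq> {H \<in> ?P. v = x \<or> v \<notin> H} \<union> {H \<in> \<F>. x \<in> H \<and> v \<in> H}" by auto
    then have "card ?P \<le> card ({H \<in> ?P. v = x \<or> v \<notin> H} \<union> {H \<in> \<F>. x \<in> H \<and> v \<in> H})"
      using fin by (intro card_mono) auto
    also have "\<dots> \<le> card {H \<in> ?P. v = x \<or> v \<notin> H} + card {H \<in> \<F>. x \<in> H \<and> v \<in> H}" by (rule card_Un_le)
    finally show ?thesis using cod[OF False[symmetric]] by linarith
  qed simp
  have "\<forall>F\<in>?P. card F = 3 \<and> x \<in> F \<and> y \<notin> F"
    "\<forall>F\<in>?Q. card F = 3 \<and> y \<in> F \<and> x \<notin> F" "\<forall>F\<in>?P. \<forall>G\<in>?Q. F \<inter> G \<noteq> {}"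
    using c3 int by auto
  \<comment> \<open>The outcomes give 1 + 3 + 3 for a single edge (the other link meets one of its
    two ends), 3 + 3 for a common centre, 4 + 4 for small links, and 2 + (1 + 3) for the last
    two.\<close>
  with P Q have "card ?P + card ?Q \<le> 8"
  proof (cases rule: cross_intersecting_links)
    case single_left
    then obtain U where U: "?P = {U}" by (auto simp: card_1_singleton_iff)
    then have U': "U \<in> \<F>" "x \<in> U" "y \<notin> U" by blast+
    obtain u v where uv: "U = {x, u, v}" "u \<noteq> x" "v \<noteq> x" "u \<noteq> y" "v \<noteq> y"
      using U' c3[OF U'(1)] by (auto simp: card_3_iff)
    have "?Q \<subseteq> {H \<in> \<F>. y \<in> H \<and> u \<in> H} \<union> {H \<in> \<F>. y \<in> H \<and> v \<in> H}"
      using int[OF U'(1)] uv by auto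
    then have "card ?Q \<le> card ({H \<in> \<F>. y \<in> H \<and> u \<in> H} \<union> {H \<in> \<F>. y \<in> H \<and> v \<in> H})"
      using fin by (intro card_mono) auto
    also have "\<dots> \<le> card {H \<in> \<F>. y \<in> H \<and> u \<in> H} + card {H \<in> \<F>. y \<in> H \<and> v \<in> H}" by (rule card_Un_le)
    finally show ?thesis using single_left cod[OF uv(4)[symmetric]] cod[OF uv(5)[symmetric]] by linarith
  next
    case single_right
    then obtain U where U: "?Q = {U}" by (auto simp: card_1_singleton_iff)
    then have U': "U \<in> \<F>" "y \<in> U" "x \<notin> U" by blast+
    obtain u v where uv: "U = {y, u, v}" "u \<noteq> x" "v \<noteq> x" "u \<noteq> y" "v \<noteq> y"
      using U' c3[OF U'(1)] by (auto simp: card_3_iff)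
    have "?P \<subseteq> {H \<in> \<F>. x \<in> H \<and> u \<in> H} \<union> {H \<in> \<F>. x \<in> H \<and> v \<in> H}"
      using int[OF U'(1)] uv by auto
    then have "card ?P \<le> card ({H \<in> \<F>. x \<in> H \<and> u \<in> H} \<union> {H \<in> \<F>. x \<in> H \<and> v \<in> H})"
      using fin by (intro card_mono) auto
    also have "\<dots> \<le> card {H \<in> \<F>. x \<in> H \<and> u \<in> H} + card {H \<in> \<F>. x \<in> H \<and> v \<in> H}" by (rule card_Un_le)
    finally show ?thesis using single_right cod[OF uv(2)[symmetric]] cod[OF uv(3)[symmetric]] by linarith
  next
    case (common v)
    then have "{H \<in> ?P. v = x \<or> v \<notin> H} = {}" "{H \<in> ?Q. v = y \<or> v \<notin> H} = {}" by blast+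
    then show ?thesis using cP[of v] cQ[of v] by (simp only: card.empty)
  next
    case small then show ?thesis by linarith
  next
    case (left v) then show ?thesis using cQ[of v] by linarith
  next
    case (right v) then show ?thesis using cP[of v] by linarith
  qed
  then show ?thesis using disj N M by linarith
qed

subsection \<open>Rotations and codegrees\<close>

lemma cdist_commute: "cdist n x y = cdist n y x"
  by (auto simp: cdist_def)

text \<open>A form free of truncated subtraction and of the case split on the order, suited to
  linear arithmetic.\<close>

lemma cdist_int:
  assumes "i \<in> {1..n}" "j \<in> {1..n}"
  shows "int (cdist n i j) = min \<bar>int i - int j\<bar> (int n - \<bar>int i - int j\<bar>)"
  using assms by (cases "i \<le> j") (auto simp: cdist_def of_nat_diff min_def)

text \<open>More rigid than the permutations in \<open>family_iso\<close>: preserving distances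
  preserves stability, so the candidate families are carried to candidate families.\<close>

definition isometry :: "nat \<Rightarrow> (nat \<Rightarrow> nat) \<Rightarrow> bool" where
  "isometry n \<pi> \<longleftrightarrow> \<pi> permutes {1..n} \<and>
     (\<forall>i\<in>{1..n}. \<forall>j\<in>{1..n}. cdist n (\<pi> i) (\<pi> j) = cdist n i j)"

text \<open>The rotation of the cycle that takes \<open>x\<close> to 1. It is the identity outside
  \<open>{1..n}\<close>, as \<open>permutes\<close> demands.\<close>

definition rot :: "nat \<Rightarrow> nat \<Rightarrow> nat \<Rightarrow> nat" where
  "rot n x i = (if i \<in> {1..n} then if x \<le> i then i + 1 - x else i + n + 1 - x else i)"

lemma isometry_rot:
  assumes "x \<in> {1..n}"
  shows "isometry n (rot n x)"
proof -
  have "inj_on (rot n x) {1..n}"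
    using assms by (auto simp: inj_on_def rot_def split: if_splits)
  moreover have "rot n x ` {1..n} \<subseteq> {1..n}"
    using assms by (auto simp: rot_def)
  ultimately have "bij_betw (rot n x) {1..n} {1..n}"
    by (simp add: bij_betw_def endo_inj_surj)
  then have "rot n x permutes {1..n}"
    by (rule bij_imp_permutes) (simp only: rot_def if_False)
  moreover have "cdist n (rot n x i) (rot n x j) = cdist n i j" if ij: "i \<in> {1..n}" "j \<in> {1..n}" for i j
  proof -
    have r: "int (rot n x k) = int k + 1 - int x + (if x \<le> k then 0 else int n)" if "k \<in> {1..n}" for k
      using that assms by (simp add: rot_def of_nat_diff)
    have m: "rot n x k \<in> {1..n}" if "k \<in> {1..n}" for k using that assms by (auto simp: rot_def)
    \<comment> \<open>The difference of two points is kept or shifted by n, so its absolute value is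
      kept or replaced by its complement to n.\<close>
    have "int (cdist n (rot n x i) (rot n x j)) = int (cdist n i j)"
      unfolding cdist_int[OF ij] cdist_int[OF m[OF ij(1)] m[OF ij(2)]] r[OF ij(1)] r[OF ij(2)]
      using ij assms by (auto simp: min_def abs_if)
    then show ?thesis by simp
  qed
  ultimately show ?thesis by (simp add: isometry_def)
qed

lemma isometry_inj: "isometry n \<pi> \<Longrightarrow> inj \<pi>"
  by (auto simp only: isometry_def dest: permutes_inj)

lemma isometry_mem: "isometry n \<pi> \<Longrightarrow> \<pi> x \<in> {1..n} \<longleftrightarrow> x \<in> {1..n}"
  by (metis isometry_def permutes_in_image)

lemma isometry_comp:
  assumes "isometry n \<pi>" "isometry n \<rho>"
  shows "isometry n (\<rho> \<circ> \<pi>)"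
proof -
  have "cdist n ((\<rho> \<circ> \<pi>) i) ((\<rho> \<circ> \<pi>) j) = cdist n i j" if "i \<in> {1..n}" "j \<in> {1..n}" for i j
    using assms that isometry_mem[OF assms(1)] unfolding isometry_def comp_def by metis
  then show ?thesis using assms permutes_compose unfolding isometry_def by blast
qed

lemma rot_self: "x \<in> {1..n} \<Longrightarrow> rot n x x = 1"
  by (simp add: rot_def)

section \<open>Stable sets and their images under isometries\<close>

lemma stable_subsetsD:
  assumes "F \<in> stable_subsets n k s"
  shows "F \<subseteq> {1..n}" "card F = k" "x \<in> F \<Longrightarrow> y \<in> F \<Longrightarrow> x \<noteq> y \<Longrightarrow> s \<le> cdist n x y"
  using assms by (auto simp: stable_subsets_def stable_def)

lemma finite_stable_subsets: "finite (stable_subsets n k s)"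
  by (rule finite_subset[of _ "Pow {1..n}"]) (auto simp: stable_subsets_def stable_def)

lemma stable_triple_iff:
  assumes "x \<noteq> y" "x \<noteq> z" "y \<noteq> z"
  shows "{x, y, z} \<in> stable_subsets n 3 s \<longleftrightarrow>
    {x, y, z} \<subseteq> {1..n} \<and> s \<le> cdist n x y \<and> s \<le> cdist n x z \<and> s \<le> cdist n y z"
  using assms cdist_commute[of n] by (auto simp: stable_subsets_def stable_def)

lemma isometry_stable_iff:
  assumes "isometry n \<pi>" "A \<subseteq> {1..n}"
  shows "\<pi> ` A \<in> stable_subsets n k s \<longleftrightarrow> A \<in> stable_subsets n k s"
proof -
  have "inj_on \<pi> A" using isometry_inj[OF assms(1)] inj_on_subset by blast
  moreover have "\<pi> ` A \<subseteq> {1..n}" using isometry_mem[OF assms(1)] assms(2) by blast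
  moreover have "cdist n (\<pi> i) (\<pi> j) = cdist n i j" if "i \<in> A" "j \<in> A" for i j
    using assms that unfolding isometry_def by blast
  moreover have "\<pi> i = \<pi> j \<longleftrightarrow> i = j" for i j using isometry_inj[OF assms(1)] by (simp add: inj_eq)
  ultimately show ?thesis
    using assms(2) by (simp add: stable_subsets_def stable_def card_image)
qed

lemma isometry_preimage:
  assumes "isometry n \<pi>" "G \<subseteq> {1..n}"
  obtains F where "F \<subseteq> {1..n}" "\<pi> ` F = G"
proof
  have p: "\<pi> permutes {1..n}" using assms by (simp add: isometry_def)
  show "inv \<pi> ` G \<subseteq> {1..n}" using permutes_image[OF permutes_inv[OF p]] assms(2) by blast
  show "\<pi> ` inv \<pi> ` G = G" using permutes_surj[OF p] by (simp add: image_f_inv_f)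
qed

lemma isometry_mem_image:
  assumes "isometry n \<pi>"
  shows "\<pi> x \<in> \<pi> ` F \<longleftrightarrow> x \<in> F"
  using isometry_inj[OF assms] by (simp add: inj_image_mem_iff)

lemma card_3_third:
  assumes "card F = 3" "x \<in> F" "y \<in> F" "x \<noteq> y"
  obtains z where "F = {x, y, z}" "z \<noteq> x" "z \<noteq> y"
  using assms by (auto simp: card_3_iff)

section \<open>Codegrees of pairs in terms of cyclic distance\<close>

definition codeg :: "nat \<Rightarrow> nat \<Rightarrow> nat \<Rightarrow> nat \<Rightarrow> nat" where
  "codeg n s x y = card {F \<in> stable_subsets n 3 s. x \<in> F \<and> y \<in> F}"

lemma codeg_isometry:
  assumes "isometry n \<pi>"
  shows "codeg n s (\<pi> x) (\<pi> y) = codeg n s x y"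
proof -
  let ?A = "{F \<in> stable_subsets n 3 s. x \<in> F \<and> y \<in> F}"
  have "{F \<in> stable_subsets n 3 s. \<pi> x \<in> F \<and> \<pi> y \<in> F} = image \<pi> ` ?A"
  proof (intro equalityI subsetI)
    fix G assume G: "G \<in> {F \<in> stable_subsets n 3 s. \<pi> x \<in> F \<and> \<pi> y \<in> F}"
    then have "G \<subseteq> {1..n}" using stable_subsetsD(1) by blast
    then obtain F where F: "F \<subseteq> {1..n}" "\<pi> ` F = G" using isometry_preimage[OF assms] by metis
    then have "F \<in> ?A"
      using G isometry_stable_iff[OF assms F(1)] isometry_mem_image[OF assms] by blast
    then show "G \<in> image \<pi> ` ?A" using F by blast
  next
    fix G assume "G \<in> image \<pi> ` ?A"
    then obtain F where F: "F \<in> ?A" "G = \<pi> ` F" by blast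
    then have "F \<subseteq> {1..n}" using stable_subsetsD(1) by blast
    then show "G \<in> {F \<in> stable_subsets n 3 s. \<pi> x \<in> F \<and> \<pi> y \<in> F}"
      using F isometry_stable_iff[OF assms] by blast
  qed
  moreover have "inj_on (image \<pi>) ?A"
    using isometry_inj[OF assms] by (simp add: inj_image_eq_iff inj_on_def)
  ultimately show ?thesis by (simp add: codeg_def card_image)
qed

lemma codeg_not_sep: "x \<noteq> y \<Longrightarrow> cdist n x y < s \<Longrightarrow> codeg n s x y = 0"
  unfolding codeg_def using stable_subsetsD(3) by (auto simp: card_eq_0_iff) (metis not_less)

text \<open>The third point lies on one of the two arcs between 1 and \<open>y\<close>, at distance
  at least \<open>s\<close> from both ends. Each summand counts one arc; truncation gives 0 for an
  arc that is too short.\<close>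

lemma codeg_1:
  assumes "y \<in> {1..n}" "s \<ge> 1" "s \<le> cdist n 1 y"
  shows "codeg n s 1 y = (y - 2 * s) + (n + 2 - 2 * s - y)"
proof -
  let ?T = "{s + 1..y - s} \<union> {y + s..n + 1 - s}"
  have sep1: "s \<le> cdist n 1 z \<longleftrightarrow> s + 1 \<le> z \<and> z + s \<le> n + 1" if "z \<in> {1..n}" for z
    using that by (simp add: cdist_def) linarith
  then have y: "y \<ge> s + 1" "y + s \<le> n + 1" using assms by auto
  have y1: "1 \<noteq> y" using y assms(2) by linarith
  have sep2: "s \<le> cdist n y z \<longleftrightarrow> z + s \<le> y \<or> y + s \<le> z"
    if "z \<in> {1..n}" "s + 1 \<le> z" "z + s \<le> n + 1" for z
    using that y cdist_int[OF assms(1) that(1)] assms(2) by linarith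
  have "{F \<in> stable_subsets n 3 s. 1 \<in> F \<and> y \<in> F} = (\<lambda>z. {1, y, z}) ` ?T"
  proof (intro equalityI subsetI)
    fix F assume F: "F \<in> {F \<in> stable_subsets n 3 s. 1 \<in> F \<and> y \<in> F}"
    then have "card F = 3" using stable_subsetsD(2) by blast
    moreover have "1 \<in> F" "y \<in> F" using F by simp_all
    ultimately obtain z where z: "F = {1, y, z}" "z \<noteq> 1" "z \<noteq> y"
      using card_3_third y1 by metis
    have zF: "z \<in> F" using z by simp
    then have zn: "z \<in> {1..n}" using F stable_subsetsD(1) by blast
    have "s \<le> cdist n 1 z" "s \<le> cdist n y z"
      using F zF stable_subsetsD(3)[of F n 3 s] z by blast+
    then have "s + 1 \<le> z" "z + s \<le> n + 1" "z + s \<le> y \<or> y + s \<le> z"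
      using sep1[OF zn] sep2[OF zn] by blast+
    then have "z \<in> ?T" by auto
    then show "F \<in> (\<lambda>z. {1, y, z}) ` ?T" using z by blast
  next
    fix F assume "F \<in> (\<lambda>z. {1, y, z}) ` ?T"
    then obtain z where z: "z \<in> ?T" "F = {1, y, z}" by blast
    then have b: "s + 1 \<le> z" "z + s \<le> n + 1" "z + s \<le> y \<or> y + s \<le> z" using y assms(2) by auto
    then have zn: "z \<in> {1..n}" using assms(2) by auto
    have "s \<le> cdist n 1 z" "s \<le> cdist n y z" using sep1[OF zn] sep2[OF zn] b by blast+
    moreover have "1 \<noteq> z" "y \<noteq> z" using b assms(2) by linarith+
    moreover have "{1, y, z} \<subseteq> {1..n}" using zn assms(1) by simp
    ultimately have "{1, y, z} \<in> stable_subsets n 3 s"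
      using stable_triple_iff[OF y1] assms(3) by blast
    then show "F \<in> {F \<in> stable_subsets n 3 s. 1 \<in> F \<and> y \<in> F}" using z by simp
  qed
  moreover have "inj_on (\<lambda>z. {1, y, z}) ?T"
  proof (rule inj_onI)
    fix z z' assume z: "z \<in> ?T" and z': "z' \<in> ?T" and eq: "{1, y, z} = {1, y, z'}"
    have "z \<noteq> 1" "z \<noteq> y" using z y assms(2) by auto
    then show "z = z'" using eq by blast
  qed
  ultimately have "codeg n s 1 y = card ?T" by (simp add: codeg_def card_image)
  also have "\<dots> = card {s + 1..y - s} + card {y + s..n + 1 - s}"
    using y assms(2) by (intro card_Un_disjoint) auto
  finally show ?thesis using y by simp
qed

text \<open>After rotating \<open>x\<close> to 1, the point at distance d is d + 1 or n + 1 - d; the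
  two choices only exchange the summands.\<close>

lemma codeg_cdist:
  assumes "x \<in> {1..n}" "y \<in> {1..n}" "s \<ge> 1" "s \<le> cdist n x y"
  shows "codeg n s x y = (cdist n x y + 1 - 2 * s) + (n + 1 - cdist n x y - 2 * s)"
proof -
  have iso: "isometry n (rot n x)" using isometry_rot assms by blast
  then have y: "rot n x y \<in> {1..n}" using assms(2) isometry_mem by blast
  have d: "cdist n x y = cdist n 1 (rot n x y)"
    using iso assms rot_self by (metis isometry_def)
  have "codeg n s x y = codeg n s 1 (rot n x y)"
    using codeg_isometry[OF iso, of s x y] rot_self assms(1) by simp
  also have "\<dots> = (rot n x y - 2 * s) + (n + 2 - 2 * s - rot n x y)"
    using codeg_1[OF y] assms d by simp
  finally have c: "codeg n s x y = (rot n x y - 2 * s) + (n + 2 - 2 * s - rot n x y)" .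
  have "cdist n x y = rot n x y - 1 \<or> cdist n x y = n + 1 - rot n x y"
    using d y by (simp add: cdist_def min_def)
  then show ?thesis using c y by auto
qed

text \<open>The long arc is never truncated, because d is at most n / 2 and n is at least 4s + 3.
  The short arc contributes d + 1 - 2s once d reaches 2s - 1, which cancels all further dependence
  on d.\<close>

lemma codeg_sep:
  assumes "x \<in> {1..n}" "y \<in> {1..n}" "s \<ge> 2" "n \<ge> 4 * s + 3" "s \<le> cdist n x y"
  shows "int (codeg n s x y) = int n - 2 * int s + 1 - min (int (cdist n x y)) (2 * int s - 1)"
proof -
  have d: "2 * cdist n x y \<le> n" using cdist_int[OF assms(1,2)] by linarith
  show ?thesis
  proof (cases "cdist n x y < 2 * s")
    case True
    then show ?thesis using codeg_cdist[OF assms(1,2) _ assms(5)] assms(3,4) by (simp add: of_nat_diff)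
  next
    case False
    then show ?thesis using codeg_cdist[OF assms(1,2) _ assms(5)] d assms(3,4) by (simp add: of_nat_diff)
  qed
qed

text \<open>For s at least 2, 2s - 1 exceeds s, so the truncated distance takes its least value s
  only at distance s. Closer pairs have codegree 0, below the bound.\<close>

lemma codeg_le:
  assumes "x \<in> {1..n}" "y \<in> {1..n}" "x \<noteq> y" "s \<ge> 2" "n \<ge> 4 * s + 3"
  shows "int (codeg n s x y) \<le> int n - 3 * int s + 1"
    and "int (codeg n s x y) = int n - 3 * int s + 1 \<Longrightarrow> cdist n x y = s"
proof -
  have "int (codeg n s x y) \<le> int n - 3 * int s + 1 \<and>
    (int (codeg n s x y) = int n - 3 * int s + 1 \<longrightarrow> cdist n x y = s)"
  proof (cases "s \<le> cdist n x y")
    case True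
    then show ?thesis using codeg_sep[OF assms(1,2,4,5)] assms(4) by (simp add: min_def)
  next
    case False
    then show ?thesis using codeg_not_sep[OF assms(3), of n s] assms(4,5) by simp
  qed
  then show "int (codeg n s x y) \<le> int n - 3 * int s + 1"
    and "int (codeg n s x y) = int n - 3 * int s + 1 \<Longrightarrow> cdist n x y = s" by blast+
qed

subsection \<open>Sizes of the two candidate families\<close>

text \<open>Three points cut the cycle into three arcs. If no arc exceeds half of it, the distances
  are the arcs and add up to n; otherwise the distance across the long arc is the sum of the other
  two.\<close>

lemma cdist_triangle_cases:
  assumes "x \<in> {1..n}" "y \<in> {1..n}" "z \<in> {1..n}"
  shows "cdist n x z = cdist n x y + cdist n y z \<or> cdist n x y = cdist n x z + cdist n y z \<or>
    cdist n y z = cdist n x y + cdist n x z \<or> cdist n x y + cdist n y z + cdist n x z = n"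
proof -
  have "int (cdist n x z) = int (cdist n x y) + int (cdist n y z) \<or>
    int (cdist n x y) = int (cdist n x z) + int (cdist n y z) \<or>
    int (cdist n y z) = int (cdist n x y) + int (cdist n x z) \<or>
    int (cdist n x y) + int (cdist n y z) + int (cdist n x z) = int n"
    using cdist_int[OF assms(1,2)] cdist_int[OF assms(1,3)] cdist_int[OF assms(2,3)] by linarith
  then show ?thesis by linarith
qed

lemma cdist_pos: "x \<in> {1..n} \<Longrightarrow> y \<in> {1..n} \<Longrightarrow> x \<noteq> y \<Longrightarrow> 0 < cdist n x y"
  by (auto simp: cdist_def)

lemma one_side_close:
  assumes "x \<in> {1..n}" "u \<in> {1..n}" "v \<in> {1..n}" "w \<in> {1..n}"
    and "r \<le> cdist n x u" "r \<le> cdist n x v" "r \<le> cdist n x w"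
    and "cdist n x u < r + s" "cdist n x v < r + s" "cdist n x w < r + s"
  shows "cdist n u v < s \<or> cdist n u w < s \<or> cdist n v w < s"
proof -
  \<comment> \<open>Two of the three points lie on the same side of \<open>x\<close>, at distances differing by less than \<open>s\<close>.\<close>
  define right where "right k \<longleftrightarrow> int k - int x \<in> {int (cdist n x k), int (cdist n x k) - int n}" for k
  have left: "int k - int x \<in> {- int (cdist n x k), int n - int (cdist n x k)}" if "k \<in> {1..n}" "\<not> right k" for k
    using cdist_int[OF assms(1) that(1)] that(2) unfolding right_def by (simp add: min_def abs_if split: if_splits)
  have close: "cdist n k l < s"
    if "k \<in> {1..n}" "l \<in> {1..n}" "right k = right l"
      "r \<le> cdist n x k" "r \<le> cdist n x l" "cdist n x k < r + s" "cdist n x l < r + s" for k l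
  proof (cases "right k")
    case True
    then have "right l" using that by simp
    then show ?thesis using True cdist_int[OF that(1,2)] that(4-7) unfolding right_def by auto
  next
    case False
    then have "\<not> right l" using that by simp
    then show ?thesis using left[OF that(1) False] left[OF that(2)] cdist_int[OF that(1,2)] that(4-7) by auto
  qed
  have "right u = right v \<or> right u = right w \<or> right v = right w" by blast
  then show ?thesis using close assms by blast
qed

text \<open>The arithmetic shared by both candidate families. If some distance is at least 2s, its
  term is 2s - 1 and the sum of the terms is at least 4s - 1, with equality exactly when the other
  two distances are s. If all are below 2s, nothing is truncated and the sum is at least 4s.\<close>

lemma truncated_sum_bound:
  fixes a b c s k m :: int
  assumes "s \<ge> 2" "s \<le> a" "s \<le> b" "s \<le> c" "2 * s \<le> a \<or> 2 * s \<le> b \<or> 2 * s \<le> c \<or> 4 * s \<le> a + b + c"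
    and k: "k = m + (4 * s - 1) - (min a (2 * s - 1) + min b (2 * s - 1) + min c (2 * s - 1))"
  shows "k \<le> m \<and> (k = m \<longleftrightarrow> a = s \<and> b = s \<or> a = s \<and> c = s \<or> c = s \<and> b = s)"
proof -
  have 1: "k \<le> m" using assms(1-5) by (auto simp: k min_def)
  have 2: "k = m" if "a = s \<and> b = s \<or> a = s \<and> c = s \<or> c = s \<and> b = s"
    using assms(1-5) that by (auto simp: k min_def)
  have 3: "k < m" if "s < a \<and> s < b \<or> s < a \<and> s < c \<or> s < b \<and> s < c"
    using assms(1-5) that by (auto simp: k min_def)
  have "a = s \<and> b = s \<or> a = s \<and> c = s \<or> c = s \<and> b = s \<or>
      s < a \<and> s < b \<or> s < a \<and> s < c \<or> s < b \<and> s < c"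
    using assms(2-4) by linarith
  then show ?thesis using 1 2 3 by fastforce
qed

lemma stable_subsets_through_triple:
  assumes "x \<noteq> y" "x \<noteq> z" "y \<noteq> z"
  shows "{F \<in> stable_subsets n 3 s. x \<in> F \<and> y \<in> F \<and> z \<in> F} =
    (if {x, y, z} \<in> stable_subsets n 3 s then {{x, y, z}} else {})"
proof -
  have "F = {x, y, z}" if F: "F \<in> stable_subsets n 3 s" "x \<in> F" "y \<in> F" "z \<in> F" for F
    using card_3_third[OF stable_subsetsD(2)[OF F(1)] F(2,3) assms(1)] F(4) assms by blast
  then have "{F \<in> stable_subsets n 3 s. x \<in> F \<and> y \<in> F \<and> z \<in> F} =
    {{x, y, z}} \<inter> stable_subsets n 3 s" by blast
  then show ?thesis by simp
qed

text \<open>Inclusion-exclusion: only \<open>{x, y, z}\<close> itself can contain more than one of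
  the pairs, and it is then counted three times.\<close>

lemma card_family_F:
  assumes "x \<noteq> y" "x \<noteq> z" "y \<noteq> z"
  shows "card (family_F n s {x, y, z}) + 2 * of_bool ({x, y, z} \<in> stable_subsets n 3 s) =
    codeg n s x y + codeg n s y z + codeg n s x z"
proof -
  let ?A = "\<lambda>x y. {F \<in> stable_subsets n 3 s. x \<in> F \<and> y \<in> F}"
  let ?I = "{F \<in> stable_subsets n 3 s. x \<in> F \<and> y \<in> F \<and> z \<in> F}"
  have fin: "finite (?A a b)" for a b using finite_stable_subsets by simp
  have fam: "family_F n s {x, y, z} = (?A x y \<union> ?A y z) \<union> ?A x z"
    using assms by (auto simp: family_F_def Int_insert_right card_insert_if split: if_splits)
  have 1: "?A x y \<inter> ?A y z = ?I" and 2: "(?A x y \<union> ?A y z) \<inter> ?A x z = ?I" by blast+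
  have "card (?A x y) + card (?A y z) = card (?A x y \<union> ?A y z) + card ?I"
    using card_Un_Int[OF fin fin, of x y y z] unfolding 1 .
  moreover have "card (?A x y \<union> ?A y z) + card (?A x z) = card (family_F n s {x, y, z}) + card ?I"
    using card_Un_Int[of "?A x y \<union> ?A y z" "?A x z"] fin unfolding 2 fam by blast
  moreover have "card ?I = of_bool ({x, y, z} \<in> stable_subsets n 3 s)"
    using stable_subsets_through_triple[OF assms] by simp
  ultimately show ?thesis unfolding codeg_def by linarith
qed

text \<open>The codegrees add up to at most 2(n - 3s + 1). If both are maximal, \<open>y\<close> is
  at distance s from \<open>x\<close> and \<open>z\<close>; then \<open>{x, y, z}\<close> is stable
  and counted twice, which saves one.\<close>

lemma card_pair_union_le:
  assumes xyz: "x \<in> {1..n}" "y \<in> {1..n}" "z \<in> {1..n}" "x \<noteq> y" "x \<noteq> z" "y \<noteq> z"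
    and sn: "s \<ge> 2" "n \<ge> 4 * s + 3"
  shows "int (card {F \<in> stable_subsets n 3 s. y \<in> F \<and> (x \<in> F \<or> z \<in> F)}) \<le> 2 * int n - 6 * int s + 1"
proof -
  let ?A = "\<lambda>x y. {F \<in> stable_subsets n 3 s. x \<in> F \<and> y \<in> F}"
  let ?I = "{F \<in> stable_subsets n 3 s. x \<in> F \<and> y \<in> F \<and> z \<in> F}"
  have fin: "finite (?A a b)" for a b using finite_stable_subsets by simp
  have 1: "?A x y \<inter> ?A y z = ?I" 
    and 2: "?A x y \<union> ?A y z = {F \<in> stable_subsets n 3 s. y \<in> F \<and> (x \<in> F \<or> z \<in> F)}" by blast+
  have eq: "codeg n s x y + codeg n s y z = card {F \<in> stable_subsets n 3 s. y \<in> F \<and> (x \<in> F \<or> z \<in> F)}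
      + of_bool ({x, y, z} \<in> stable_subsets n 3 s)"
    using card_Un_Int[OF fin fin, of x y y z] stable_subsets_through_triple[OF xyz(4-6)]
    unfolding 1 2 codeg_def by simp
  have "{x, y, z} \<in> stable_subsets n 3 s" if "cdist n x y = s" "cdist n y z = s"
  proof -
    have "s \<le> cdist n x z"
      using cdist_triangle_cases[OF xyz(1-3)] that cdist_pos[OF xyz(1,3,5)] sn by linarith
    then show ?thesis using stable_triple_iff[OF xyz(4-6)] that xyz by simp
  qed
  then show ?thesis
    using eq codeg_le[OF xyz(1,2,4) sn] codeg_le[OF xyz(2,3,6) sn] by fastforce
qed

lemma family_F_extremal:
  assumes xyz: "x \<in> {1..n}" "y \<in> {1..n}" "z \<in> {1..n}" "x \<noteq> y" "x \<noteq> z" "y \<noteq> z"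
    and sn: "s \<ge> 2" "n \<ge> 4 * s + 3"
  shows "int (card (family_F n s {x, y, z})) \<le> 3 * int n - 10 * int s + 2"
    and "int (card (family_F n s {x, y, z})) = 3 * int n - 10 * int s + 2 \<longleftrightarrow>
      cdist n x y = s \<and> cdist n y z = s \<or> cdist n x y = s \<and> cdist n x z = s \<or>
      cdist n x z = s \<and> cdist n y z = s"
proof -
  let ?c = "int (codeg n s x y) + int (codeg n s y z) + int (codeg n s x z)"
  have c: "int (card (family_F n s {x, y, z})) = ?c - 2 * of_bool ({x, y, z} \<in> stable_subsets n 3 s)"
    using card_family_F[OF xyz(4-6), of n s] by (auto simp: of_bool_def)
  have st: "{x, y, z} \<in> stable_subsets n 3 s \<longleftrightarrow> s \<le> cdist n x y \<and> s \<le> cdist n x z \<and> s \<le> cdist n y z"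
    using stable_triple_iff[OF xyz(4-6)] xyz by auto
  let ?t = "min (int (cdist n x y)) (2 * int s - 1) + min (int (cdist n y z)) (2 * int s - 1) +
    min (int (cdist n x z)) (2 * int s - 1)"
  note tri = cdist_triangle_cases[OF xyz(1-3)]
  note pos = cdist_pos[OF xyz(1,2,4)] cdist_pos[OF xyz(1,3,5)] cdist_pos[OF xyz(2,3,6)]
  have "int (card (family_F n s {x, y, z})) \<le> 3 * int n - 10 * int s + 2 \<and>
    (int (card (family_F n s {x, y, z})) = 3 * int n - 10 * int s + 2 \<longleftrightarrow>
      cdist n x y = s \<and> cdist n y z = s \<or> cdist n x y = s \<and> cdist n x z = s \<or>
      cdist n x z = s \<and> cdist n y z = s)"
  proof (cases "{x, y, z} \<in> stable_subsets n 3 s")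
    case True
      have sep: "s \<le> cdist n x y" "s \<le> cdist n y z" "s \<le> cdist n x z" using True st by auto
    \<comment> \<open>Either one distance is the sum of two others, each at least s, or the three
      add up to n.\<close>
    then have "2 * int s \<le> int (cdist n x y) \<or> 2 * int s \<le> int (cdist n y z) \<or> 2 * int s \<le> int (cdist n x z) \<or>
      4 * int s \<le> int (cdist n x y) + int (cdist n y z) + int (cdist n x z)"
      using tri sep sn by linarith
    moreover have "int (card (family_F n s {x, y, z})) = 3 * int n - 10 * int s + 2 + (4 * int s - 1) - ?t"
      using True c codeg_sep[OF xyz(1,2) sn sep(1)] codeg_sep[OF xyz(2,3) sn sep(2)] codeg_sep[OF xyz(1,3) sn sep(3)]
      by simp
    moreover have "2 \<le> int s" "int s \<le> int (cdist n x y)" "int s \<le> int (cdist n y z)" "int s \<le> int (cdist n x z)" using sn(1) sep by simp_all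
    ultimately show ?thesis
      using truncated_sum_bound[of "int s" "int (cdist n x y)" "int (cdist n y z)" "int (cdist n x z)",
          unfolded of_nat_eq_iff] by blast
  next
    case False
    \<comment> \<open>If two of the distances were s, the third would be 2s or n - 2s, as 0 is
      excluded, and the triple would be stable.\<close>
    have neg: "\<not> (cdist n x y = s \<and> cdist n y z = s \<or> cdist n x y = s \<and> cdist n x z = s \<or>
      cdist n x z = s \<and> cdist n y z = s)"
      using False st tri sn pos by linarith
    have "int (card (family_F n s {x, y, z})) = ?c" using False c by simp
    \<comment> \<open>A triple that is not stable contains a pair of codegree 0; two codegrees alone
      stay below the bound since n > 4s.\<close>
    moreover have "?c \<le> 2 * (int n - 3 * int s + 1)"
      using False st codeg_not_sep[OF xyz(4), of n s] codeg_not_sep[OF xyz(5), of n s] codeg_not_sep[OF xyz(6), of n s]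
        codeg_le(1)[OF xyz(1,2,4) sn] codeg_le(1)[OF xyz(1,3,5) sn] codeg_le(1)[OF xyz(2,3,6) sn]
      by fastforce
    ultimately have "int (card (family_F n s {x, y, z})) < 3 * int n - 10 * int s + 2" 
      using sn[THEN of_nat_mono[where 'a = int]] by simp
    then show ?thesis using neg by simp
  qed
  then show "int (card (family_F n s {x, y, z})) \<le> 3 * int n - 10 * int s + 2"
    and "int (card (family_F n s {x, y, z})) = 3 * int n - 10 * int s + 2 \<longleftrightarrow>
      cdist n x y = s \<and> cdist n y z = s \<or> cdist n x y = s \<and> cdist n x z = s \<or>
      cdist n x z = s \<and> cdist n y z = s" by blast+
qed

text \<open>Inclusion-exclusion over the pairs of \<open>x\<close> with a point of \<open>Y\<close>.
  No triple contains \<open>x\<close> and all of \<open>Y\<close>, so there is no threefold term;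
  the final 1 counts \<open>Y\<close>.\<close>

lemma card_family_G:
  assumes Y: "{u, v, w} \<in> stable_subsets n 3 s"
    and d: "u \<noteq> v" "u \<noteq> w" "v \<noteq> w" "x \<noteq> u" "x \<noteq> v" "x \<noteq> w"
  shows "card (family_G n s x {u, v, w}) + of_bool ({x, u, v} \<in> stable_subsets n 3 s)
      + of_bool ({x, u, w} \<in> stable_subsets n 3 s) + of_bool ({x, v, w} \<in> stable_subsets n 3 s) =
    codeg n s x u + codeg n s x v + codeg n s x w + 1"
proof -
  let ?A = "\<lambda>y. {F \<in> stable_subsets n 3 s. x \<in> F \<and> y \<in> F}"
  let ?I = "\<lambda>y z. {F \<in> stable_subsets n 3 s. x \<in> F \<and> y \<in> F \<and> z \<in> F}"
  have fin: "finite (?A a)" for a using finite_stable_subsets by simp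
  have finI: "finite (?I a b)" for a b using finite_stable_subsets by simp
  have I: "card (?I a b) = of_bool ({x, a, b} \<in> stable_subsets n 3 s)" if "x \<noteq> a" "x \<noteq> b" "a \<noteq> b" for a b
    using stable_subsets_through_triple[OF that] by simp
  have fam: "family_G n s x {u, v, w} = insert {u, v, w} ((?A u \<union> ?A v) \<union> ?A w)"
    unfolding family_G_def by blast
  have "card (family_G n s x {u, v, w}) = card ((?A u \<union> ?A v) \<union> ?A w) + 1"
    unfolding fam using d fin by (subst card_insert_disjoint) auto
  moreover have "card (?A u) + card (?A v) = card (?A u \<union> ?A v) + card (?I u v)"
  proof -
    have "?A u \<inter> ?A v = ?I u v" by blast
    then show ?thesis using card_Un_Int[OF fin fin, of u v] by simp
  qed
  moreover have "card (?A u \<union> ?A v) + card (?A w) = card ((?A u \<union> ?A v) \<union> ?A w) + card (?I u w \<union> ?I v w)"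
  proof -
    have "(?A u \<union> ?A v) \<inter> ?A w = ?I u w \<union> ?I v w" by blast
    then show ?thesis using card_Un_Int[of "?A u \<union> ?A v" "?A w"] fin by simp
  qed
  moreover have "card (?I u w \<union> ?I v w) = card (?I u w) + card (?I v w)"
  proof (rule card_Un_disjoint[OF finI finI])
    show "?I u w \<inter> ?I v w = {}"
    proof (rule ccontr)
      assume "?I u w \<inter> ?I v w \<noteq> {}"
      then obtain F where F: "F \<in> stable_subsets n 3 s" "{x, u, v, w} \<subseteq> F" by blast
      have "card {x, u, v, w} \<le> card F"
        using F stable_subsetsD[OF F(1)] by (intro card_mono) (auto intro: finite_subset)
      then show False using d stable_subsetsD(2)[OF F(1)] by simp
    qed
  qed
  ultimately show ?thesis using I[OF d(4,5,1)] I[OF d(4,6,2)] I[OF d(5,6,3)] unfolding codeg_def by linarith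
qed

lemma family_G_extremal:
  assumes Y: "{u, v, w} \<in> stable_subsets n 3 s" and x: "x \<in> {1..n}"
    and d: "u \<noteq> v" "u \<noteq> w" "v \<noteq> w" "x \<noteq> u" "x \<noteq> v" "x \<noteq> w"
    and sn: "s \<ge> 2" "n \<ge> 4 * s + 3"
  shows "int (card (family_G n s x {u, v, w})) \<le> 3 * int n - 10 * int s + 2"
    and "int (card (family_G n s x {u, v, w})) = 3 * int n - 10 * int s + 2 \<longleftrightarrow>
      s \<le> cdist n x u \<and> s \<le> cdist n x v \<and> s \<le> cdist n x w \<and>
      (cdist n x u = s \<and> cdist n x v = s \<or> cdist n x u = s \<and> cdist n x w = s \<or>
       cdist n x w = s \<and> cdist n x v = s)"
proof -
  let ?c = "int (codeg n s x u) + int (codeg n s x v) + int (codeg n s x w)"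
  let ?t = "min (int (cdist n x u)) (2 * int s - 1) + min (int (cdist n x v)) (2 * int s - 1) +
    min (int (cdist n x w)) (2 * int s - 1)"
  have uvw: "u \<in> {1..n}" "v \<in> {1..n}" "w \<in> {1..n}" using stable_subsetsD(1)[OF Y] by auto
  have sep: "s \<le> cdist n u v" "s \<le> cdist n u w" "s \<le> cdist n v w"
    using Y stable_triple_iff[OF d(1-3)] by auto
  have c: "int (card (family_G n s x {u, v, w})) = ?c + 1 - of_bool (s \<le> cdist n x u \<and> s \<le> cdist n x v)
    - of_bool (s \<le> cdist n x u \<and> s \<le> cdist n x w) - of_bool (s \<le> cdist n x v \<and> s \<le> cdist n x w)"
    using card_family_G[OF Y d] stable_triple_iff[OF d(4,5,1), of n s] stable_triple_iff[OF d(4,6,2), of n s]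
      stable_triple_iff[OF d(5,6,3), of n s] uvw x sep by (auto simp: of_bool_def split: if_splits)
  have "int (card (family_G n s x {u, v, w})) \<le> 3 * int n - 10 * int s + 2 \<and>
    (int (card (family_G n s x {u, v, w})) = 3 * int n - 10 * int s + 2 \<longleftrightarrow>
      s \<le> cdist n x u \<and> s \<le> cdist n x v \<and> s \<le> cdist n x w \<and>
      (cdist n x u = s \<and> cdist n x v = s \<or> cdist n x u = s \<and> cdist n x w = s \<or>
       cdist n x w = s \<and> cdist n x v = s))"
  proof (cases "s \<le> cdist n x u \<and> s \<le> cdist n x v \<and> s \<le> cdist n x w")
    case True
    \<comment> \<open>Three pairwise separated points cannot all lie at distance between s and 2s -
      1 from \<open>x\<close>, because two of them would be on the same side.\<close>
    have "2 * s \<le> cdist n x u \<or> 2 * s \<le> cdist n x v \<or> 2 * s \<le> cdist n x w"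
      using one_side_close[OF x uvw, of s s] True sep by linarith
    then have "2 * int s \<le> int (cdist n x u) \<or> 2 * int s \<le> int (cdist n x v) \<or> 2 * int s \<le> int (cdist n x w) \<or>
      4 * int s \<le> int (cdist n x u) + int (cdist n x v) + int (cdist n x w)" by linarith
    moreover have "int (card (family_G n s x {u, v, w})) = 3 * int n - 10 * int s + 2 + (4 * int s - 1) - ?t"
      using True c codeg_sep[OF x uvw(1) sn] codeg_sep[OF x uvw(2) sn] codeg_sep[OF x uvw(3) sn]
      by simp
    moreover have "2 \<le> int s" "int s \<le> int (cdist n x u)" "int s \<le> int (cdist n x v)" "int s \<le> int (cdist n x w)" using sn(1) True by simp_all
    ultimately show ?thesis
      using truncated_sum_bound[of "int s" "int (cdist n x u)" "int (cdist n x v)" "int (cdist n x w)",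
          unfolded of_nat_eq_iff] True by blast
  next
    case False
    have "?c \<le> 2 * (int n - 3 * int s + 1)"
      using False codeg_not_sep[OF d(4), of n s] codeg_not_sep[OF d(5), of n s] codeg_not_sep[OF d(6), of n s]
        codeg_le(1)[OF x uvw(1) d(4) sn] codeg_le(1)[OF x uvw(2) d(5) sn] codeg_le(1)[OF x uvw(3) d(6) sn]
      by fastforce
    moreover have "int (card (family_G n s x {u, v, w})) \<le> ?c + 1" using c by (simp add: of_bool_def)
    ultimately have "int (card (family_G n s x {u, v, w})) < 3 * int n - 10 * int s + 2" 
      using sn[THEN of_nat_mono[where 'a = int]] by simp
    then show ?thesis using False by auto
  qed
  then show "int (card (family_G n s x {u, v, w})) \<le> 3 * int n - 10 * int s + 2"
    and "int (card (family_G n s x {u, v, w})) = 3 * int n - 10 * int s + 2 \<longleftrightarrow>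
      s \<le> cdist n x u \<and> s \<le> cdist n x v \<and> s \<le> cdist n x w \<and>
      (cdist n x u = s \<and> cdist n x v = s \<or> cdist n x u = s \<and> cdist n x w = s \<or>
       cdist n x w = s \<and> cdist n x v = s)" by blast+
qed

subsection \<open>Isomorphism with the normal forms\<close>

lemma family_iso_family_F:
  assumes "isometry n \<pi>" "X \<subseteq> {1..n}"
  shows "family_iso n 3 (family_F n s X) (family_F n s (\<pi> ` X))"
proof -
  have inj: "inj \<pi>" using assms(1) by (rule isometry_inj)
  have "A \<in> family_F n s X \<longleftrightarrow> \<pi> ` A \<in> family_F n s (\<pi> ` X)" if "A \<subseteq> {1..n}" for A
  proof -
    have "card (\<pi> ` A \<inter> \<pi> ` X) = card (A \<inter> X)"
      using inj by (simp add: image_Int[symmetric] card_image inj_on_subset)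
    then show ?thesis using isometry_stable_iff[OF assms(1) that] by (simp add: family_F_def)
  qed
  then show ?thesis using assms(1) unfolding family_iso_def isometry_def by blast
qed

lemma family_iso_family_G:
  assumes "isometry n \<pi>" "Y \<subseteq> {1..n}"
  shows "family_iso n 3 (family_G n s x Y) (family_G n s (\<pi> x) (\<pi> ` Y))"
proof -
  have inj: "inj \<pi>" using assms(1) by (rule isometry_inj)
  have "A \<in> family_G n s x Y \<longleftrightarrow> \<pi> ` A \<in> family_G n s (\<pi> x) (\<pi> ` Y)" if "A \<subseteq> {1..n}" for A
  proof -
    have "\<pi> ` A \<inter> \<pi> ` Y = {} \<longleftrightarrow> A \<inter> Y = {}"
      using inj by (simp add: image_Int[symmetric])
    moreover have "\<pi> ` A = \<pi> ` Y \<longleftrightarrow> A = Y" using inj by (rule inj_image_eq_iff)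
    ultimately show ?thesis
      using isometry_stable_iff[OF assms(1) that] isometry_mem_image[OF assms(1)] by (simp add: family_G_def)
  qed
  then show ?thesis using assms(1) unfolding family_iso_def isometry_def by blast
qed

text \<open>\<open>family_iso\<close> speaks only about k-subsets of \<open>{1..n}\<close>. When all
  members are of this kind, taking images under the permutation is a bijection between the
  families.\<close>

lemma card_eq_family_iso:
  assumes "family_iso n k \<F> \<H>"
    and F: "\<And>A. A \<in> \<F> \<Longrightarrow> A \<subseteq> {1..n} \<and> card A = k"
    and H: "\<And>A. A \<in> \<H> \<Longrightarrow> A \<subseteq> {1..n} \<and> card A = k"
  shows "card \<F> = card \<H>"
proof -
  obtain \<pi> where p: "\<pi> permutes {1..n}"
    and iff: "\<And>A. A \<subseteq> {1..n} \<Longrightarrow> card A = k \<Longrightarrow> A \<in> \<F> \<longleftrightarrow> \<pi> ` A \<in> \<H>"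
    using assms(1) unfolding family_iso_def by blast
  have inj: "inj \<pi>" using p by (rule permutes_inj)
  have "\<H> = image \<pi> ` \<F>"
  proof (intro equalityI subsetI)
    fix B assume B: "B \<in> \<H>"
    have eq: "\<pi> ` inv \<pi> ` B = B" using permutes_surj[OF p] by (simp add: image_f_inv_f)
    have "inv \<pi> ` B \<subseteq> {1..n}" using permutes_image[OF permutes_inv[OF p]] H[OF B] by blast
    moreover have "card (inv \<pi> ` B) = k"
      using H[OF B] permutes_inj[OF permutes_inv[OF p]] by (simp add: card_image inj_on_subset)
    ultimately have "inv \<pi> ` B \<in> \<F>" using iff B eq by simp
    then show "B \<in> image \<pi> ` \<F>" using eq by (metis image_eqI)
  next
    fix B assume "B \<in> image \<pi> ` \<F>"
    then show "B \<in> \<H>" using F iff by blast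
  qed
  moreover have "inj_on (image \<pi>) \<F>" using inj by (simp add: inj_on_def inj_image_eq_iff)
  ultimately show ?thesis by (simp add: card_image)
qed

lemma family_iso_comp_image:
  assumes "isometry n \<pi>" "isometry n \<rho>" "X \<subseteq> {1..n}"
  shows "family_iso n 3 (family_F n s X) (family_F n s (\<rho> ` \<pi> ` X))"
  using family_iso_family_F[OF isometry_comp[OF assms(1,2)] assms(3)] by (simp add: image_comp)

lemma cdist_1_eq:
  assumes "y \<in> {1..n}" "cdist n 1 y = s" "s \<ge> 1"
  shows "y = s + 1 \<or> y = n - s + 1"
  using assms by (auto simp: cdist_def min_def split: if_splits)

text \<open>Only s + 1 and n - s + 1 are at distance s from 1. The images are given as an unordered
  pair since the sides of \<open>u\<close> and \<open>w\<close> are not known.\<close>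

lemma rot_pair:
  assumes "x \<in> {1..n}" "u \<in> {1..n}" "w \<in> {1..n}" "u \<noteq> w" "cdist n x u = s" "cdist n x w = s" "s \<ge> 1"
  shows "{rot n x u, rot n x w} = {s + 1, n - s + 1}"
proof -
  have iso: "isometry n (rot n x)" using assms(1) by (rule isometry_rot)
  have d: "cdist n 1 (rot n x k) = cdist n x k" if "k \<in> {1..n}" for k
    using iso assms(1) that rot_self unfolding isometry_def by metis
  have "rot n x k = s + 1 \<or> rot n x k = n - s + 1" if "k \<in> {1..n}" "cdist n x k = s" for k
    using cdist_1_eq[of "rot n x k" n s] isometry_mem[OF iso] d that assms(7) by blast
  moreover have "rot n x u \<noteq> rot n x w" using isometry_inj[OF iso] assms(4) by (simp add: inj_eq)
  ultimately show ?thesis using assms by (metis insert_commute)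
qed

text \<open>Two rotations: the middle point \<open>y\<close> goes to 1, giving
  \<open>{1, s + 1, n - s + 1}\<close>; then n - s + 1 goes to 1, which takes 1 to s + 1 and s + 1
  to 2s + 1.\<close>

lemma family_F_extremal_iso:
  assumes xyz: "x \<in> {1..n}" "y \<in> {1..n}" "z \<in> {1..n}" "x \<noteq> z" "cdist n y x = s" "cdist n y z = s"
    and sn: "s \<ge> 2" "n \<ge> 4 * s + 3"
  shows "family_iso n 3 (family_F n s {x, y, z}) (family_F n s {1, s + 1, 2 * s + 1})"
proof -
  have 1: "rot n y ` {x, y, z} = {1, s + 1, n - s + 1}"
    using rot_pair[OF xyz(2,1,3,4,5,6)] rot_self[OF xyz(2)] sn by auto
  have b: "n - s + 1 \<in> {1..n}" using sn by auto
  have 2: "rot n (n - s + 1) ` {1, s + 1, n - s + 1} = {1, s + 1, 2 * s + 1}"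
    using sn by (simp add: rot_def) auto
  have "{x, y, z} \<subseteq> {1..n}" using xyz by blast
  from family_iso_comp_image[OF isometry_rot[OF xyz(2)] isometry_rot[OF b] this, of s]
  show ?thesis unfolding 1 2 .
qed

text \<open>The rotation taking \<open>x\<close> to 1 sends \<open>u\<close> and \<open>w\<close> to
  s + 1 and n - s + 1. The image of \<open>v\<close> is separated from 1, hence lies between these
  two, and separation from both gives the interval for \<open>y\<close>.\<close>

lemma family_G_extremal_iso:
  assumes Y: "{u, v, w} \<in> stable_subsets n 3 s" and x: "x \<in> {1..n}"
    and d: "u \<noteq> v" "u \<noteq> w" "v \<noteq> w"
    and dist: "cdist n x u = s" "cdist n x w = s" "s \<le> cdist n x v"
    and sn: "s \<ge> 2" "n \<ge> 4 * s + 3"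
  shows "\<exists>y\<in>{2 * s + 1..n - 2 * s + 1}.
    family_iso n 3 (family_G n s x {u, v, w}) (family_G n s 1 {s + 1, y, n - s + 1})"
proof (rule bexI)
  have uvw: "u \<in> {1..n}" "v \<in> {1..n}" "w \<in> {1..n}" using stable_subsetsD(1)[OF Y] by auto
  have iso: "isometry n (rot n x)" using x by (rule isometry_rot)
  have im: "{rot n x u, rot n x w} = {s + 1, n - s + 1}"
    using rot_pair[OF x uvw(1,3) d(2) dist(1,2)] sn by simp
  then have "rot n x ` {u, v, w} = {s + 1, rot n x v, n - s + 1}" by auto
  then show "family_iso n 3 (family_G n s x {u, v, w}) (family_G n s 1 {s + 1, rot n x v, n - s + 1})"
    using family_iso_family_G[OF iso stable_subsetsD(1)[OF Y], of s x] rot_self[OF x] by simp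
  have v: "rot n x v \<in> {1..n}" using isometry_mem[OF iso] uvw by blast
  have iso': "cdist n (rot n x k) (rot n x l) = cdist n k l" if "k \<in> {1..n}" "l \<in> {1..n}" for k l
    using iso that unfolding isometry_def by blast
  have sep: "s \<le> cdist n u v" "s \<le> cdist n w v"
    using Y stable_triple_iff[OF d] cdist_commute[of n v w] by auto
  have "s \<le> cdist n (rot n x u) (rot n x v)" "s \<le> cdist n (rot n x w) (rot n x v)"
    using sep iso' uvw by simp_all
  then have far: "s \<le> cdist n (s + 1) (rot n x v)" "s \<le> cdist n (n - s + 1) (rot n x v)"
    using im by (metis doubleton_eq_iff)+
  have "s \<le> cdist n 1 (rot n x v)" using iso'[OF x uvw(2)] dist(3) rot_self[OF x] by simp
  then have "s + 1 \<le> rot n x v" "rot n x v + s \<le> n + 1" using v by (auto simp: cdist_def split: if_splits)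
  moreover have "s + 1 \<in> {1..n}" "n - s + 1 \<in> {1..n}" "int (n - s + 1) = int n - int s + 1"
    using sn by auto
  ultimately have "2 * s + 1 \<le> rot n x v" "rot n x v + 2 * s \<le> n + 1"
    using far cdist_int[of "s + 1" n "rot n x v"] cdist_int[of "n - s + 1" n "rot n x v"] v sn
    by linarith+
  then show "rot n x v \<in> {2 * s + 1..n - 2 * s + 1}" by simp
qed

subsection \<open>Reduction to the candidate families\<close>

text \<open>Apart from at most 2 + 1 exceptional members, the family consists of triples that
  contain \<open>y\<close> together with \<open>x\<close> or \<open>v\<close>.\<close>

lemma card_lt_two_left:
  assumes sn: "s \<ge> 2" "n \<ge> 4 * s + 3" and FS: "\<F> \<subseteq> stable_subsets n 3 s"
    and cover: "\<forall>F\<in>\<F>. x \<in> F \<or> y \<in> F" and xy: "x \<in> {1..n}" "y \<in> {1..n}" "x \<noteq> y"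
    and P: "card {F \<in> \<F>. x \<in> F \<and> y \<notin> F} \<le> 2"
    and Q: "card {F \<in> {F \<in> \<F>. y \<in> F \<and> x \<notin> F}. v = y \<or> v \<notin> F} \<le> 1"
  shows "int (card \<F>) < 3 * int n - 10 * int s + 2"
proof -
  let ?P = "{F \<in> \<F>. x \<in> F \<and> y \<notin> F}" and ?Q = "{F \<in> {F \<in> \<F>. y \<in> F \<and> x \<notin> F}. v = y \<or> v \<notin> F}"
  let ?R = "{F \<in> stable_subsets n 3 s. y \<in> F \<and> (x \<in> F \<or> v \<noteq> y \<and> v \<in> F)}"
  have finF: "finite \<F>" using FS finite_stable_subsets finite_subset by blast
  have "\<F> \<subseteq> ?P \<union> ?Q \<union> ?R" using FS cover by blast
  then have "card \<F> \<le> card (?P \<union> ?Q \<union> ?R)"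
    using finF finite_stable_subsets by (intro card_mono) auto
  also have "\<dots> \<le> card ?P + card ?Q + card ?R"
    by (meson add_le_mono card_Un_le le_refl order_trans)
  finally have le: "card \<F> \<le> 3 + card ?R" using P Q by linarith
  have "int (card ?R) \<le> 2 * int n - 6 * int s + 1"
  proof (cases "v \<in> {1..n} \<and> v \<noteq> x \<and> v \<noteq> y")
    case True
    then have "?R = {F \<in> stable_subsets n 3 s. y \<in> F \<and> (x \<in> F \<or> v \<in> F)}" by blast
    then show ?thesis using card_pair_union_le[of x n y v s] True xy sn by simp
  next
    case False
    \<comment> \<open>A \<open>v\<close> off the ground set or equal to \<open>x\<close> or
      \<open>y\<close> yields no further pair.\<close>
    then have "?R = {F \<in> stable_subsets n 3 s. x \<in> F \<and> y \<in> F}" using stable_subsetsD(1) by blast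
    then have "card ?R = codeg n s x y" by (simp add: codeg_def)
    then show ?thesis using codeg_le(1)[OF xy sn] sn by linarith
  qed
  moreover have "4 * int s + 3 \<le> int n" using sn by linarith
  \<comment> \<open>3 + (2n - 6s + 1) is below 3n - 10s + 2 exactly when n is at least 4s +
    3.\<close>
  ultimately show ?thesis using le by linarith
qed

lemma card_family_G_cases:
  assumes sn: "s \<ge> 2" "n \<ge> 4 * s + 3" and Y: "Y \<in> stable_subsets n 3 s" and x: "x \<in> {1..n}" "x \<notin> Y"
    and sub: "\<F> \<subseteq> family_G n s x Y"
  shows "int (card \<F>) \<le> 3 * int n - 10 * int s + 2 \<and>
    (int (card \<F>) = 3 * int n - 10 * int s + 2 \<longrightarrow>
       (\<exists>y \<in> {2 * s + 1..n - 2 * s + 1}. family_iso n 3 \<F> (family_G n s 1 {s + 1, y, n - s + 1})))"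
proof -
  obtain u v w where uvw: "Y = {u, v, w}" "u \<noteq> v" "u \<noteq> w" "v \<noteq> w"
    using stable_subsetsD(2)[OF Y] by (auto simp: card_3_iff)
  have xn: "x \<noteq> u" "x \<noteq> v" "x \<noteq> w" using x uvw by auto
  have fin: "finite (family_G n s x Y)" using finite_stable_subsets by (simp add: family_G_def)
  have le: "card \<F> \<le> card (family_G n s x Y)" using sub fin by (rule card_mono[rotated])
  note G = family_G_extremal[OF Y[unfolded uvw(1)] x(1) uvw(2-4) xn sn, folded uvw(1)]
  have iso: "\<exists>y \<in> {2 * s + 1..n - 2 * s + 1}.
      family_iso n 3 (family_G n s x Y) (family_G n s 1 {s + 1, y, n - s + 1})"
    if "Y = {a, b, c}" "a \<noteq> b" "a \<noteq> c" "b \<noteq> c" "cdist n x a = s" "cdist n x c = s" "s \<le> cdist n x b" for a b c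
    using family_G_extremal_iso[OF Y[unfolded that(1)] x(1) that(2-7) sn] unfolding that(1) .
  have "\<exists>y \<in> {2 * s + 1..n - 2 * s + 1}. family_iso n 3 \<F> (family_G n s 1 {s + 1, y, n - s + 1})"
    if eq: "int (card \<F>) = 3 * int n - 10 * int s + 2"
  proof -
    have "\<F> = family_G n s x Y" using sub fin le eq G(1) by (intro card_subset_eq) auto
    \<comment> \<open>The isomorphism lemma expects the two points at distance s in first and last
      place, so each of the three possible pairs needs its own ordering of \<open>Y\<close>.\<close>
    moreover have perm: "Y = {u, w, v}" "Y = {v, u, w}" using uvw(1) by auto
    moreover have "int (card (family_G n s x Y)) = 3 * int n - 10 * int s + 2" using eq G(1) le by linarith
    ultimately show ?thesis
      using G(2) iso[of u v w] iso[of u w v] iso[of v u w] uvw by metis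
  qed
  then show ?thesis using le G(1) by linarith
qed

lemma card_family_F_cases:
  assumes sn: "s \<ge> 2" "n \<ge> 4 * s + 3"
    and xyz: "x \<in> {1..n}" "y \<in> {1..n}" "z \<in> {1..n}" "x \<noteq> y" "x \<noteq> z" "y \<noteq> z"
    and sub: "\<F> \<subseteq> family_F n s {x, y, z}"
  shows "int (card \<F>) \<le> 3 * int n - 10 * int s + 2 \<and>
    (int (card \<F>) = 3 * int n - 10 * int s + 2 \<longrightarrow> family_iso n 3 \<F> (family_F n s {1, s + 1, 2 * s + 1}))"
proof -
  have fin: "finite (family_F n s {x, y, z})" using finite_stable_subsets by (simp add: family_F_def)
  have le: "card \<F> \<le> card (family_F n s {x, y, z})" using sub fin by (rule card_mono[rotated])
  note F = family_F_extremal[OF xyz sn]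
  have "family_iso n 3 \<F> (family_F n s {1, s + 1, 2 * s + 1})" if eq: "int (card \<F>) = 3 * int n - 10 * int s + 2"
  proof -
    have Feq: "\<F> = family_F n s {x, y, z}" using sub fin le eq F(1) by (intro card_subset_eq) auto
    then consider "cdist n x y = s" "cdist n y z = s" | "cdist n x y = s" "cdist n x z = s"
      | "cdist n x z = s" "cdist n y z = s"
      using F(2) eq by blast
    then show ?thesis
    proof cases
      case 1
      then show ?thesis
        using family_F_extremal_iso[OF xyz(1,2,3,5) _ _ sn] Feq cdist_commute[of n x y] by simp
    next
      case 2
      then show ?thesis
        using family_F_extremal_iso[OF xyz(2,1,3,6) _ _ sn] Feq by (simp add: insert_commute)
    next
      case 3
      then show ?thesis
        using family_F_extremal_iso[OF xyz(1,3,2,4) _ _ sn] Feq cdist_commute[of n x z] cdist_commute[of n y z]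
        by (simp add: insert_commute)
    qed
  qed
  then show ?thesis using le F(1) by linarith
qed

text \<open>In a non-star, every point is missed by some member. Hence a covering pair consists of
  two distinct points, and each of them lies in a member that misses the other.\<close>

lemma nonstar_stable_triples:
  assumes sn: "s \<ge> 2" "n \<ge> 4 * s + 3" and FS: "\<F> \<subseteq> stable_subsets n 3 s" and "nonstar \<F>"
  shows "int (card \<F>) \<le> 3 * int n - 10 * int s + 2 \<and>
    (int (card \<F>) = 3 * int n - 10 * int s + 2 \<longrightarrow>
       family_iso n 3 \<F> (family_F n s {1, s + 1, 2 * s + 1}) \<or>
       (\<exists>y \<in> {2 * s + 1..n - 2 * s + 1}. family_iso n 3 \<F> (family_G n s 1 {s + 1, y, n - s + 1})))"
proof -
  have int: "\<And>F G. F \<in> \<F> \<Longrightarrow> G \<in> \<F> \<Longrightarrow> F \<inter> G \<noteq> {}" and ns: "\<And>x. \<exists>F\<in>\<F>. x \<notin> F"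
    using \<open>nonstar \<F>\<close> by (auto simp: nonstar_def star_def intersecting_def)
  have fin: "finite \<F>" using FS finite_stable_subsets finite_subset by blast
  have c3: "card F = 3" and sub: "F \<subseteq> {1..n}" if "F \<in> \<F>" for F using FS stable_subsetsD that by blast+
  have ns': "4 * int s + 3 \<le> int n" "2 \<le> int s" using sn by linarith+
  let ?b = "3 * int n - 10 * int s + 2"
  show ?thesis
  proof (cases "\<exists>x y. \<forall>F\<in>\<F>. x \<in> F \<or> y \<in> F")
    case False
    then have "\<exists>F\<in>\<F>. x \<notin> F \<and> y \<notin> F" for x y by blast
    with fin c3 int have "card \<F> \<le> 13" by (rule card_no_two_cover)
    then have "int (card \<F>) < ?b" using ns' by linarith
    then show ?thesis by simp
  next
    case True
    then obtain x y where cover: "\<forall>F\<in>\<F>. x \<in> F \<or> y \<in> F" by blast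
    have neq: "x \<noteq> y" using cover ns by blast
    let ?P = "{F \<in> \<F>. x \<in> F \<and> y \<notin> F}" and ?Q = "{F \<in> \<F>. y \<in> F \<and> x \<notin> F}"
    have ne: "?P \<noteq> {}" "?Q \<noteq> {}" using ns cover by blast+
    then have xy: "x \<in> {1..n}" "y \<in> {1..n}" using sub by blast+
    have "\<forall>F\<in>?P. card F = 3 \<and> x \<in> F \<and> y \<notin> F"
      "\<forall>F\<in>?Q. card F = 3 \<and> y \<in> F \<and> x \<notin> F" "\<forall>F\<in>?P. \<forall>G\<in>?Q. F \<inter> G \<noteq> {}"
      using c3 int by auto
    with ne show ?thesis
    proof (cases rule: cross_intersecting_links)
      case single_left
      then obtain U where U: "?P = {U}" by (auto simp: card_1_singleton_iff)
      then have UF: "U \<in> \<F>" "y \<notin> U" by blast+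
      \<comment> \<open>With \<open>U\<close> the only member missing \<open>y\<close>, the centre
        is \<open>y\<close>, and all other members meet \<open>U\<close> by intersection.\<close>
      have "\<F> \<subseteq> family_G n s y U"
      proof
        fix F assume F: "F \<in> \<F>"
        have "F = U \<or> y \<in> F" using U cover F by blast
        then show "F \<in> family_G n s y U"
          using F FS int[OF F UF(1)] unfolding family_G_def by blast
      qed
      from card_family_G_cases[OF sn subsetD[OF FS UF(1)] xy(2) UF(2) this] show ?thesis by blast
    next
      case single_right
      then obtain U where U: "?Q = {U}" by (auto simp: card_1_singleton_iff)
      then have UF: "U \<in> \<F>" "x \<notin> U" by blast+
      have "\<F> \<subseteq> family_G n s x U"
      proof
        fix F assume F: "F \<in> \<F>"
        have "F = U \<or> x \<in> F" using U cover F by blast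
        then show "F \<in> family_G n s x U"
          using F FS int[OF F UF(1)] unfolding family_G_def by blast
      qed
      from card_family_G_cases[OF sn subsetD[OF FS UF(1)] xy(1) UF(2) this] show ?thesis by blast
    next
      case (common v)
      then have v: "v \<in> {1..n}" using ne sub by blast
      have "F \<in> family_F n s {x, y, v}" if F: "F \<in> \<F>" for F
      proof -
        have "{x, y} \<subseteq> F \<or> {x, v} \<subseteq> F \<or> {y, v} \<subseteq> F" using common(3) cover F by blast
        then have "2 \<le> card (F \<inter> {x, y, v})"
          using common(1,2) neq by (auto simp: Int_insert_right card_insert_if)
        then show ?thesis using F FS by (auto simp: family_F_def)
      qed
      then show ?thesis
        using card_family_F_cases[OF sn xy v neq common(1,2)[symmetric], of \<F>] by blast
    next
      case small
      let ?M = "{F \<in> \<F>. x \<in> F \<and> y \<in> F}"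
      have "\<F> \<subseteq> ?P \<union> ?Q \<union> ?M" using cover by blast
      then have "card \<F> \<le> card (?P \<union> ?Q \<union> ?M)" using fin by (intro card_mono) auto
      also have "\<dots> \<le> card ?P + card ?Q + card ?M"
        by (meson add_le_mono card_Un_le le_refl order_trans)
      finally have "card \<F> \<le> card ?P + card ?Q + card ?M" .
      moreover have "card {F \<in> \<F>. x \<in> F \<and> y \<in> F} \<le> codeg n s x y"
        unfolding codeg_def using FS finite_stable_subsets by (intro card_mono) auto
      \<comment> \<open>8 + (n - 3s + 1) is below the bound when 2n > 7s + 7; this holds as 2n is at
        least 8s + 6 and s is at least 2.\<close>
      ultimately have "int (card \<F>) < ?b" using small codeg_le(1)[OF xy neq sn] ns' by linarith
      then show ?thesis by simp
    next
      case (left v)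
      then have "int (card \<F>) < ?b" by (rule card_lt_two_left[OF sn FS cover xy neq])
      then show ?thesis by simp
    next
      case (right v)
      have cover': "\<forall>F\<in>\<F>. y \<in> F \<or> x \<in> F" using cover by blast
      from right have "int (card \<F>) < ?b" by (rule card_lt_two_left[OF sn FS cover' xy(2,1) neq[symmetric]])
      then show ?thesis by simp
    qed
  qed
qed

section \<open>Sizes of the normal forms and the equivalence\<close>

lemma card_family_F_1:
  assumes sn: "s \<ge> 2" "n \<ge> 4 * s + 3"
  shows "int (card (family_F n s {1, s + 1, 2 * s + 1})) = 3 * int n - 10 * int s + 2"
proof -
  have "cdist n 1 (s + 1) = s" "cdist n (s + 1) (2 * s + 1) = s" using sn by (auto simp: cdist_def)
  then show ?thesis using family_F_extremal(2)[of 1 n "s + 1" "2 * s + 1" s] sn by simp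
qed

lemma card_family_G_1:
  assumes sn: "s \<ge> 2" "n \<ge> 4 * s + 3" and y: "y \<in> {2 * s + 1..n - 2 * s + 1}"
  shows "{s + 1, y, n - s + 1} \<in> stable_subsets n 3 s"
    and "int (card (family_G n s 1 {s + 1, y, n - s + 1})) = 3 * int n - 10 * int s + 2"
proof -
  have d: "s + 1 \<noteq> y" "s + 1 \<noteq> n - s + 1" "y \<noteq> n - s + 1" "1 \<noteq> s + 1" "1 \<noteq> y" "1 \<noteq> n - s + 1"
    using sn y by auto
  have c: "cdist n 1 (s + 1) = s" "cdist n 1 (n - s + 1) = s" "s \<le> cdist n 1 y"
    using sn y by (auto simp: cdist_def)
  have "s \<le> cdist n (s + 1) y" "s \<le> cdist n (s + 1) (n - s + 1)" "s \<le> cdist n y (n - s + 1)"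
    using sn y by (auto simp: cdist_def)
  then show st: "{s + 1, y, n - s + 1} \<in> stable_subsets n 3 s"
    using stable_triple_iff[OF d(1-3)] sn y by auto
  show "int (card (family_G n s 1 {s + 1, y, n - s + 1})) = 3 * int n - 10 * int s + 2"
    using family_G_extremal(2)[OF st _ d sn] c sn by simp
qed

theorem theorem1p10:
  fixes n s :: nat and \<F> :: "nat set set"
  assumes "s \<ge> 2" and "n \<ge> 4 * s + 3"
    and "\<F> \<subseteq> stable_subsets n 3 s"
    and "nonstar \<F>"
  shows "int (card \<F>) \<le> 3 * int n - 10 * int s + 2 \<and>
    (int (card \<F>) = 3 * int n - 10 * int s + 2 \<longleftrightarrow>
       family_iso n 3 \<F> (family_F n s {1, s + 1, 2 * s + 1}) \<or>
       (\<exists>y \<in> {2 * s + 1..n - 2 * s + 1}.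
          family_iso n 3 \<F> (family_G n s 1 {s + 1, y, n - s + 1})))"
proof -
  note sn = assms(1,2)
  have F3: "A \<subseteq> {1..n} \<and> card A = 3" if "A \<in> \<F>" for A
    using assms(3) that stable_subsetsD(1,2) by blast
  \<comment> \<open>For the converse, counting suffices: an isomorphism need not preserve distances,
    but it preserves the number of members.\<close>
  have "int (card \<F>) = 3 * int n - 10 * int s + 2"
    if "family_iso n 3 \<F> (family_F n s {1, s + 1, 2 * s + 1})"
  proof -
    have "A \<subseteq> {1..n} \<and> card A = 3" if "A \<in> family_F n s {1, s + 1, 2 * s + 1}" for A
      using that stable_subsetsD(1,2) unfolding family_F_def by blast
    then show ?thesis using card_eq_family_iso[OF that F3] card_family_F_1[OF sn] by simp
  qed
  moreover have "int (card \<F>) = 3 * int n - 10 * int s + 2"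
    if y: "y \<in> {2 * s + 1..n - 2 * s + 1}" and iso: "family_iso n 3 \<F> (family_G n s 1 {s + 1, y, n - s + 1})" for y
  proof -
    have "A \<in> stable_subsets n 3 s" if "A \<in> family_G n s 1 {s + 1, y, n - s + 1}" for A
      using that card_family_G_1(1)[OF sn y] unfolding family_G_def by blast
    then have "A \<subseteq> {1..n} \<and> card A = 3" if "A \<in> family_G n s 1 {s + 1, y, n - s + 1}" for A
      using that stable_subsetsD(1,2) by blast
    then show ?thesis using card_eq_family_iso[OF iso F3] card_family_G_1(2)[OF sn y] by simp
  qed
  ultimately show ?thesis using nonstar_stable_triples[OF assms] by blast
qed

end
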